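(* Let $\Omega\subset\mathbb{R}^2$ be a Lipschitz polygonal domain, and let $0<\epsilon<k$. Then, for every $h>0$, there exist $u_h^{\epsilon,k}\in V_h$ and $H_h\in W_{h,\mathbb{C}}$ such that $\tilde H_h:=H_h-H_\circ\in V_{h,\mathbb{C}}$ and, for all $(Q_h,v_h)\in V_{h,\mathbb{C}}\times V_h$, $$(\nabla\tilde H_h,\nabla Q_h)_{\Omega,\mathbb{C}}+(i\omega\mu(u_h^{(\epsilon,k)+})\tilde H_h,Q_h)_{\Omega,\mathbb{C}}=(i\omega\mu(u_h^{(\epsilon,k)+})H_\circ,Q_h)_{\Omega,\mathbb{C}},$$ $$(\nabla u_h^{(\epsilon,k)+},\nabla v_h)_\Omega+s(u_h^{(\epsilon,k)-},v_h)=(|\nabla H_h|^2,v_h)_\Omega,$$ where $u_h^{(\epsilon,k)+}$ and $u_h^{(\epsilon,k)-}$ are the constrained and complementary parts of $u_h^{\epsilon,k}$.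
   Context: $\Omega$ is open and bounded. $\omega>0$ is a constant and $H_\circ\in\mathbb{C}$ is a constant (also viewed as a constant function). $\mu:\mathbb{R}\to\mathbb{R}$ is Lipschitz continuous and there are constants $\mu_\circ,\mu^\circ$ with $0<\mu_\circ\le\mu(s)\le\mu^\circ$ for all $s\in\mathbb{R}$. $(f,g)_\Omega=\int_\Omega f\cdot g\,d\boldsymbol{x}$ for real functions and $(f,g)_{\Omega,\mathbb{C}}=\int_\Omega f\cdot\bar g\,d\boldsymbol{x}$ for complex functions. $\{\mathcal{T}_h\}_{h>0}$ is a shape-regular family of simplicial triangulations of $\Omega$, $h$ being the mesh size. $W_h$ (resp. $W_{h,\mathbb{C}}$) is the space of continuous real-valued (resp. complex-valued) functions on $\overline\Omega$ whose restriction to each $K\in\mathcal{T}_h$ is a polynomial of degree at most $1$ with real (resp. complex) coefficients; $V_h=W_h\cap H^1_0(\Omega)$ and $V_{h,\mathbb{C}}=W_{h,\mathbb{C}}\cap H^1_0(\Omega;\mathbb{C})$. Let $\boldsymbol{x}_1,\dots,\boldsymbol{x}_n$ be the internal nodes of $\mathcal{T}_h$ and $\phi_1,\dots,\phi_n$ the Lagrange (nodal) basis of $V_h$. Any $v_h\in V_h$ is split as $v_h=v_h^{(\epsilon,k)+}+v_h^{(\epsilon,k)-}$ with $$v_h^{(\epsilon,k)+}=\sum_{i=1}^n\max\{-\epsilon,\min\{v_h(\boldsymbol{x}_i),k\}\}\,\phi_i,\qquad v_h^{(\epsilon,k)-}=v_h-v_h^{(\epsilon,k)+};$$ for $v_h=u_h^{\epsilon,k}$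 these parts are written $u_h^{(\epsilon,k)+}$, $u_h^{(\epsilon,k)-}$. The stabilising bilinear form is $s(v_h,w_h)=\alpha\sum_{i=1}^n v_h(\boldsymbol{x}_i)w_h(\boldsymbol{x}_i)$ with a constant $\alpha>0$. *)

theory Defs
  imports "HOL-Analysis.Analysis"
begin

text \<open>Functions on \<open>\<Omega>\<close> or on its closure are total functions on \<^typ>\<open>real ^ 2\<close>; their values
  elsewhere never matter. Real- and complex-valued functions are treated together, with values
  in a type \<open>'b\<close>.\<close>

definition lipschitz_boundary :: "(real ^ 2) set \<Rightarrow> bool" where
  "lipschitz_boundary \<Omega> \<longleftrightarrow>
     (\<forall>x\<in>frontier \<Omega>. \<exists>r>0. \<exists>e1 e2 :: real ^ 2. \<exists>\<gamma> :: real \<Rightarrow> real. \<exists>L.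
        norm e1 = 1 \<and> norm e2 = 1 \<and> e1 \<bullet> e2 = 0 \<and> L-lipschitz_on UNIV \<gamma> \<and>
        \<Omega> \<inter> ball x r = {y \<in> ball x r. \<gamma> (y \<bullet> e1) < y \<bullet> e2})"

definition lipschitz_polygonal_domain :: "(real ^ 2) set \<Rightarrow> bool" where
  "lipschitz_polygonal_domain \<Omega> \<longleftrightarrow>
     open \<Omega> \<and> bounded \<Omega> \<and> connected \<Omega> \<and> \<Omega> \<noteq> {} \<and> lipschitz_boundary \<Omega> \<and>
     (\<exists>S. finite S \<and> frontier \<Omega> = (\<Union>(a, b)\<in>S. closed_segment a b))"

definition pderiv_at :: "(real ^ 2 \<Rightarrow> 'b::real_normed_vector) \<Rightarrow> 2 \<Rightarrow> real ^ 2 \<Rightarrow> 'b" where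
  "pderiv_at f i x = frechet_derivative f (at x) (axis i 1)"

text \<open>\<open>C_diff m f\<close> says that \<open>f\<close> is of class \<open>C\<^sup>m\<close> on the whole plane.\<close>

primrec C_diff :: "nat \<Rightarrow> (real ^ 2 \<Rightarrow> 'b::real_normed_vector) \<Rightarrow> bool" where
  "C_diff 0 f \<longleftrightarrow> continuous_on UNIV f"
| "C_diff (Suc m) f \<longleftrightarrow> f differentiable_on UNIV \<and> (\<forall>i. C_diff m (pderiv_at f i))"

definition test_function :: "(real ^ 2) set \<Rightarrow> (real ^ 2 \<Rightarrow> 'b::real_normed_vector) \<Rightarrow> bool" where
  "test_function \<Omega> \<psi> \<longleftrightarrow>
     (\<forall>m. C_diff m \<psi>) \<and> compact (closure {x. \<psi> x \<noteq> 0}) \<and> closure {x. \<psi> x \<noteq> 0} \<subseteq> \<Omega>"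

definition locally_integrable :: "(real ^ 2) set \<Rightarrow> (real ^ 2 \<Rightarrow> 'b::euclidean_space) \<Rightarrow> bool" where
  "locally_integrable \<Omega> f \<longleftrightarrow> (\<forall>C. compact C \<and> C \<subseteq> \<Omega> \<longrightarrow> set_integrable lebesgue C f)"

definition square_integrable :: "(real ^ 2) set \<Rightarrow> (real ^ 2 \<Rightarrow> 'b::euclidean_space) \<Rightarrow> bool" where
  "square_integrable \<Omega> f \<longleftrightarrow>
     set_borel_measurable lebesgue \<Omega> f \<and> set_integrable lebesgue \<Omega> (\<lambda>x. (norm (f x))\<^sup>2)"

definition has_weak_gradient ::
  "(real ^ 2) set \<Rightarrow> (real ^ 2 \<Rightarrow> 'b::euclidean_space) \<Rightarrow> (real ^ 2 \<Rightarrow> 'b ^ 2) \<Rightarrow> bool" where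
  "has_weak_gradient \<Omega> f g \<longleftrightarrow>
     locally_integrable \<Omega> f \<and> locally_integrable \<Omega> g \<and>
     (\<forall>\<psi> :: real ^ 2 \<Rightarrow> real. test_function \<Omega> \<psi> \<longrightarrow>
        (\<forall>i. (LINT x:\<Omega>|lebesgue. pderiv_at \<psi> i x *\<^sub>R f x) =
             - (LINT x:\<Omega>|lebesgue. \<psi> x *\<^sub>R (g x $ i))))"

text \<open>The weak gradient is unique only up to null sets; some representative is chosen.\<close>

definition grad ::
  "(real ^ 2) set \<Rightarrow> (real ^ 2 \<Rightarrow> 'b::euclidean_space) \<Rightarrow> real ^ 2 \<Rightarrow> 'b ^ 2" where
  "grad \<Omega> f = (SOME g. has_weak_gradient \<Omega> f g)"

text \<open>\<open>H\<^sup>1\<^sub>0(\<Omega>)\<close> is the closure of the test functions in \<open>H\<^sup>1(\<Omega>)\<close>.\<close>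

definition H1 :: "(real ^ 2) set \<Rightarrow> (real ^ 2 \<Rightarrow> 'b::euclidean_space) set" where
  "H1 \<Omega> = {f. square_integrable \<Omega> f \<and> (\<exists>g. has_weak_gradient \<Omega> f g \<and> square_integrable \<Omega> g)}"

definition H1_0 :: "(real ^ 2) set \<Rightarrow> (real ^ 2 \<Rightarrow> 'b::euclidean_space) set" where
  "H1_0 \<Omega> = {f \<in> H1 \<Omega>. \<exists>\<psi> :: nat \<Rightarrow> real ^ 2 \<Rightarrow> 'b. (\<forall>n. test_function \<Omega> (\<psi> n)) \<and>
     (\<lambda>n. LINT x:\<Omega>|lebesgue. (norm (\<psi> n x - f x))\<^sup>2) \<longlonglongrightarrow> 0 \<and>
     (\<lambda>n. LINT x:\<Omega>|lebesgue. (norm ((\<chi> i. pderiv_at (\<psi> n) i x) - grad \<Omega> f x))\<^sup>2) \<longlonglongrightarrow> 0}"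

text \<open>The library predicate \<^const>\<open>triangulation\<close> states finiteness and conformity: two cells
  meet in a common (possibly empty) face.\<close>

definition triangulation_of :: "(real ^ 2) set \<Rightarrow> (real ^ 2) set set \<Rightarrow> bool" where
  "triangulation_of \<Omega> T \<longleftrightarrow>
     triangulation T \<and> (\<forall>K\<in>T. 2 simplex K) \<and> \<Union>T = closure \<Omega>"

definition mesh_size :: "(real ^ 2) set set \<Rightarrow> real" where
  "mesh_size T = Max (diameter ` T)"

definition inradius :: "(real ^ 2) set \<Rightarrow> real" where
  "inradius K = Sup {r. 0 \<le> r \<and> (\<exists>x. cball x r \<subseteq> K)}"

text \<open>The mesh size of a triangulation of a bounded set is bounded, so a family in which \<open>h\<close>
  is the mesh size of \<open>T h\<close> cannot be indexed by all positive reals. The index set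
  \<open>I\<close> holds the mesh sizes that occur.\<close>

definition shape_regular_family ::
  "(real ^ 2) set \<Rightarrow> real set \<Rightarrow> (real \<Rightarrow> (real ^ 2) set set) \<Rightarrow> bool" where
  "shape_regular_family \<Omega> I T \<longleftrightarrow>
     I \<subseteq> {0<..} \<and> (\<forall>h\<in>I. triangulation_of \<Omega> (T h) \<and> mesh_size (T h) = h) \<and>
     (\<exists>\<sigma>. \<forall>h\<in>I. \<forall>K\<in>T h. diameter K \<le> \<sigma> * inradius K)"

definition internal_nodes :: "(real ^ 2) set \<Rightarrow> (real ^ 2) set set \<Rightarrow> (real ^ 2) set" where
  "internal_nodes \<Omega> T = {z \<in> \<Omega>. \<exists>K\<in>T. z extreme_point_of K}"

text \<open>\<open>W\<^sub>h\<close> and \<open>V\<^sub>h\<close>, resp. their complex versions, for \<open>'b = real\<close>, resp. \<open>'b = complex\<close>.\<close>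

definition W_space :: "(real ^ 2) set \<Rightarrow> (real ^ 2) set set \<Rightarrow> (real ^ 2 \<Rightarrow> 'b::euclidean_space) set" where
  "W_space \<Omega> T = {f. continuous_on (closure \<Omega>) f \<and>
     (\<forall>K\<in>T. \<exists>c :: 'b. \<exists>d :: 'b ^ 2. \<forall>x\<in>K. f x = c + (\<Sum>i\<in>UNIV. (x $ i) *\<^sub>R (d $ i)))}"

definition V_space :: "(real ^ 2) set \<Rightarrow> (real ^ 2) set set \<Rightarrow> (real ^ 2 \<Rightarrow> 'b::euclidean_space) set" where
  "V_space \<Omega> T = W_space \<Omega> T \<inter> H1_0 \<Omega>"

text \<open>The basis functions are indexed by the internal nodes themselves. Linear independence is
  implied by the nodal values; the last conjunct says that the functions span \<open>V\<^sub>h\<close>.\<close>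

definition lagrange_basis ::
  "(real ^ 2) set \<Rightarrow> (real ^ 2) set set \<Rightarrow> (real ^ 2 \<Rightarrow> real ^ 2 \<Rightarrow> real) \<Rightarrow> bool" where
  "lagrange_basis \<Omega> T \<phi> \<longleftrightarrow>
     (\<forall>z\<in>internal_nodes \<Omega> T. \<phi> z \<in> V_space \<Omega> T \<and>
        (\<forall>y\<in>internal_nodes \<Omega> T. \<phi> z y = (if y = z then 1 else 0))) \<and>
     (\<forall>v\<in>V_space \<Omega> T. \<exists>c. \<forall>x\<in>closure \<Omega>. v x = (\<Sum>z\<in>internal_nodes \<Omega> T. c z * \<phi> z x))"

definition constrained_part ::
  "(real ^ 2) set \<Rightarrow> (real ^ 2 \<Rightarrow> real ^ 2 \<Rightarrow> real) \<Rightarrow> real \<Rightarrow> real \<Rightarrow> (real ^ 2 \<Rightarrow> real) \<Rightarrow> real ^ 2 \<Rightarrow> real" where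
  "constrained_part N \<phi> \<epsilon> k v = (\<lambda>x. \<Sum>z\<in>N. max (- \<epsilon>) (min (v z) k) * \<phi> z x)"

definition complementary_part ::
  "(real ^ 2) set \<Rightarrow> (real ^ 2 \<Rightarrow> real ^ 2 \<Rightarrow> real) \<Rightarrow> real \<Rightarrow> real \<Rightarrow> (real ^ 2 \<Rightarrow> real) \<Rightarrow> real ^ 2 \<Rightarrow> real" where
  "complementary_part N \<phi> \<epsilon> k v = (\<lambda>x. v x - constrained_part N \<phi> \<epsilon> k v x)"

definition stab_form ::
  "(real ^ 2) set \<Rightarrow> real \<Rightarrow> (real ^ 2 \<Rightarrow> real) \<Rightarrow> (real ^ 2 \<Rightarrow> real) \<Rightarrow> real" where
  "stab_form N \<alpha> v w = \<alpha> * (\<Sum>z\<in>N. v z * w z)"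

definition L2_real :: "(real ^ 2) set \<Rightarrow> (real ^ 2 \<Rightarrow> real) \<Rightarrow> (real ^ 2 \<Rightarrow> real) \<Rightarrow> real" where
  "L2_real \<Omega> f g = (LINT x:\<Omega>|lebesgue. f x * g x)"

definition L2_real_vec :: "(real ^ 2) set \<Rightarrow> (real ^ 2 \<Rightarrow> real ^ 2) \<Rightarrow> (real ^ 2 \<Rightarrow> real ^ 2) \<Rightarrow> real" where
  "L2_real_vec \<Omega> f g = (LINT x:\<Omega>|lebesgue. f x \<bullet> g x)"

definition L2_complex :: "(real ^ 2) set \<Rightarrow> (real ^ 2 \<Rightarrow> complex) \<Rightarrow> (real ^ 2 \<Rightarrow> complex) \<Rightarrow> complex" where
  "L2_complex \<Omega> f g = (LINT x:\<Omega>|lebesgue. f x * cnj (g x))"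

definition L2_complex_vec ::
  "(real ^ 2) set \<Rightarrow> (real ^ 2 \<Rightarrow> complex ^ 2) \<Rightarrow> (real ^ 2 \<Rightarrow> complex ^ 2) \<Rightarrow> complex" where
  "L2_complex_vec \<Omega> f g = (LINT x:\<Omega>|lebesgue. (\<Sum>i\<in>UNIV. f x $ i * cnj (g x $ i)))"

end

theory Submission
  imports Defs
begin

text \<open>
  The key is that the temperature enters the stiffness term, and through \<open>\<mu>\<close> the magnetic equation,
  only by way of its constrained part, whose nodal values lie in the box \<open>[-\<epsilon>, k]\<^sup>n\<close>.
  Let \<open>P\<close> be the nodal truncation to this box, \<open>A\<close> the stiffness matrix and \<open>b(p)\<close> the vector of
  integrals of \<open>\<bar>\<nabla>H\<bar>\<^sup>2\<close> against the basis functions, where \<open>H\<close> solves the magnetic equation with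
  coefficient \<open>\<mu>\<close> taken at the function with nodal values \<open>p\<close>. For the nodal values \<open>U\<close> of the
  unknown, the stabilised heat equation reads \<open>A P(U) + \<alpha> (U - P(U)) = b(P(U))\<close>, that is,
  \<open>U = G(P(U))\<close> with \<open>G(p) = p + (b(p) - A p) / \<alpha>\<close>. Brouwer's theorem gives a fixed point
  \<open>p = P(G(p))\<close> in the box, and \<open>U = G(p)\<close> then satisfies \<open>P(U) = p\<close> and solves the equation
  (\<open>discrete_solution_exists\<close>).

  Brouwer's theorem is wanted for a number of unknowns that is not the dimension of a fixed type, so
  it is derived for cubes of real sequences from Kuhn's combinatorial lemma
  (\<open>brouwer_cube_coordinates\<close>). The continuity of \<open>b\<close> comes down to that of the solution of the
  magnetic system in its coefficients. The form of this system takes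
  at \<open>v\<close> a value with imaginary part \<open>\<omega> \<integral> \<mu> \<bar>v\<bar>\<^sup>2\<close>, which is positive for \<open>v \<noteq> 0\<close>. So Gaussian elimination
  runs without pivoting and yields the solution by continuous operations (\<open>linear_system_continuous_solution\<close>).

  The analytic part connects these finite systems with the integrals in the theorem. A weak
  gradient is determined almost everywhere (\<open>weak_gradient_unique\<close>, by means of explicit smooth
  bumps), so \<open>grad\<close>, which picks some representative, is linear almost everywhere, and the
  forms of nodal combinations expand into finite sums. Closure of \<open>H\<^sup>1\<^sub>0(\<Omega>)\<close> under sums and bounded
  linear maps puts nodal combinations with complex coefficients into the complex space
  \<open>V\<^sub>h\<close>, and, applied to \<open>Re\<close> and \<open>Im\<close>, shows that every element of this space is such a
  combination on the closure of \<open>\<Omega>\<close>.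
\<close>

section \<open>Fixed points and linear systems in finitely many coordinates\<close>

text \<open>Gaussian elimination. A unit vector in the definiteness hypothesis shows that the diagonal entry at
\<open>z\<close> never vanishes, so \<open>z\<close> can be eliminated without pivoting. The Schur complement inherits the
hypothesis: extending a vector \<open>c\<close> on the remaining indices by the value at \<open>z\<close> that annihilates
row \<open>z\<close> leaves the value of the form unchanged. Each step divides by a nonvanishing continuous
function only, so the solution is continuous in the parameter.\<close>

lemma linear_system_continuous_solution:
  fixes M :: "'a \<Rightarrow> 'a \<Rightarrow> 'p::topological_space \<Rightarrow> complex"
  assumes "finite N"
    and "\<And>x y. x \<in> N \<Longrightarrow> y \<in> N \<Longrightarrow> continuous_on S (M x y)"
    and "\<And>x. x \<in> N \<Longrightarrow> continuous_on S (r x)"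
    and "\<And>p c. p \<in> S \<Longrightarrow> \<exists>x\<in>N. c x \<noteq> 0 \<Longrightarrow>
           (\<Sum>x\<in>N. cnj (c x) * (\<Sum>y\<in>N. M x y p * c y)) \<noteq> 0"
  shows "\<exists>c :: 'a \<Rightarrow> 'p \<Rightarrow> complex. (\<forall>x\<in>N. continuous_on S (c x)) \<and>
           (\<forall>p\<in>S. \<forall>x\<in>N. (\<Sum>y\<in>N. M x y p * c y p) = r x p)"
  using assms
proof (induction N arbitrary: M r rule: finite_induct)
  case empty
  show ?case by simp
next
  case (insert z N M r)
  have piv: "M z z p \<noteq> 0" if "p \<in> S" for p
  proof -
    have *: "(\<Sum>y\<in>N. M x y p * (if y = z then 1 else 0)) = 0"
      and **: "(\<Sum>x\<in>N. cnj (if x = z then 1 else 0) * f x) = 0" for x and f :: "'a \<Rightarrow> complex"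
      using insert.hyps by (auto intro!: sum.neutral)
    show ?thesis
      using insert.prems(3)[OF that, of "\<lambda>y. if y = z then 1 else 0"] insert.hyps
      by (simp add: sum.insert * **)
  qed
  define M' where "M' = (\<lambda>x y p. M x y p - M x z p * M z y p / M z z p)"
  define r' where "r' = (\<lambda>x p. r x p - M x z p * r z p / M z z p)"
  have "\<exists>c :: 'a \<Rightarrow> 'p \<Rightarrow> complex. (\<forall>x\<in>N. continuous_on S (c x)) \<and>
           (\<forall>p\<in>S. \<forall>x\<in>N. (\<Sum>y\<in>N. M' x y p * c y p) = r' x p)"
  proof (rule insert.IH)
    show "continuous_on S (M' x y)" if "x \<in> N" "y \<in> N" for x y
      unfolding M'_def using that piv by (intro continuous_intros insert.prems) auto
    show "continuous_on S (r' x)" if "x \<in> N" for x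
      unfolding r'_def using that piv by (intro continuous_intros insert.prems) auto
    fix p and c :: "'a \<Rightarrow> complex"
    assume p: "p \<in> S" and c: "\<exists>x\<in>N. c x \<noteq> 0"
    \<comment> \<open>The entry at \<open>z\<close> is chosen so that row \<open>z\<close> of the full system annihilates \<open>d\<close>.\<close>
    define d where "d = c(z := - (\<Sum>y\<in>N. M z y p * c y) / M z z p)"
    have dN: "d y = c y" if "y \<in> N" for y
      using that insert.hyps by (auto simp: d_def)
    have sd: "(\<Sum>y\<in>N. M x y p * d y) = (\<Sum>y\<in>N. M x y p * c y)" for x
      by (rule sum.cong) (auto simp: dN)
    have rz: "(\<Sum>y\<in>insert z N. M z y p * d y) = 0"
      using insert.hyps piv[OF p] by (simp add: sd) (simp add: d_def)
    have rx: "(\<Sum>y\<in>insert z N. M x y p * d y) = (\<Sum>y\<in>N. M' x y p * c y)" for x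
    proof -
      have "(\<Sum>y\<in>N. M' x y p * c y)
          = (\<Sum>y\<in>N. M x y p * c y) - (M x z p / M z z p) * (\<Sum>y\<in>N. M z y p * c y)"
        by (simp add: M'_def sum_distrib_left sum_subtractf algebra_simps)
      also have "\<dots> = M x z p * d z + (\<Sum>y\<in>N. M x y p * c y)"
        by (simp add: d_def)
      finally show ?thesis using insert.hyps by (simp add: sd)
    qed
    have "(\<Sum>x\<in>insert z N. cnj (d x) * (\<Sum>y\<in>insert z N. M x y p * d y)) \<noteq> 0"
      using insert.prems(3)[OF p, of d] c dN by auto
    also have "(\<Sum>x\<in>insert z N. cnj (d x) * (\<Sum>y\<in>insert z N. M x y p * d y))
        = (\<Sum>x\<in>N. cnj (d x) * (\<Sum>y\<in>insert z N. M x y p * d y))"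
      using insert.hyps by (subst sum.insert) (simp_all only: rz, simp_all)
    also have "\<dots> = (\<Sum>x\<in>N. cnj (c x) * (\<Sum>y\<in>N. M' x y p * c y))"
      by (rule sum.cong) (simp_all only: rx dN)
    finally show "(\<Sum>x\<in>N. cnj (c x) * (\<Sum>y\<in>N. M' x y p * c y)) \<noteq> 0" .
  qed
  then obtain c :: "'a \<Rightarrow> 'p \<Rightarrow> complex" where cc: "\<And>x. x \<in> N \<Longrightarrow> continuous_on S (c x)"
    and ce: "\<And>p x. p \<in> S \<Longrightarrow> x \<in> N \<Longrightarrow> (\<Sum>y\<in>N. M' x y p * c y p) = r' x p"
    by blast
  define d where "d = c(z := \<lambda>p. (r z p - (\<Sum>y\<in>N. M z y p * c y p)) / M z z p)"
  have dN: "d y = c y" if "y \<in> N" for y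
    using that insert.hyps by (auto simp: d_def)
  have sd: "(\<Sum>y\<in>N. M x y p * d y p) = (\<Sum>y\<in>N. M x y p * c y p)" for x p
    by (rule sum.cong) (auto simp: dN)
  have "continuous_on S (d x)" if "x \<in> insert z N" for x
  proof (cases "x = z")
    case True
    have "continuous_on S (\<lambda>p. (r z p - (\<Sum>y\<in>N. M z y p * c y p)) / M z z p)"
      using piv by (intro continuous_intros insert.prems cc) auto
    then show ?thesis using True by (simp add: d_def)
  next
    case False
    then show ?thesis using that dN cc by auto
  qed
  moreover have "(\<Sum>y\<in>insert z N. M x y p * d y p) = r x p" if "p \<in> S" "x \<in> insert z N" for p x
  proof (cases "x = z")
    case True
    then show ?thesis using insert.hyps piv[OF that(1)] by (simp add: sd) (simp add: d_def)
  next
    case False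
    then have x: "x \<in> N" using that by simp
    have eq: "(\<Sum>y\<in>N. M' x y p * c y p)
        = (\<Sum>y\<in>N. M x y p * c y p) - (M x z p / M z z p) * (\<Sum>y\<in>N. M z y p * c y p)"
      by (simp add: M'_def sum_distrib_left sum_subtractf algebra_simps)
    have sol: "(\<Sum>y\<in>N. M x y p * c y p)
        = (M x z p / M z z p) * (\<Sum>y\<in>N. M z y p * c y p) + (r x p - M x z p * r z p / M z z p)"
      using ce[OF that(1) x] unfolding eq r'_def diff_eq_eq by (simp only: add.commute)
    have dz: "d z p = (r z p - (\<Sum>y\<in>N. M z y p * c y p)) / M z z p"
      by (simp add: d_def)
    show ?thesis
      unfolding sum.insert[OF insert.hyps] sd dz sol by (simp add: diff_divide_distrib algebra_simps)
  qed
  ultimately show ?case by blast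
qed

text \<open>Brouwer's theorem with the number \<open>n\<close> of active coordinates as a variable of the logic. Points are
real sequences; the cube is compact in the product topology, which is metrizable. Label a vertex of
the grid of mesh \<open>1/p\<close> in direction \<open>i\<close> by whether \<open>f\<close> moves it up or down; Kuhn's lemma gives a grid
cell in which both labels occur for every direction, and a limit of such cells is a fixed point.\<close>

lemma brouwer_cube_coordinates:
  fixes f :: "(nat \<Rightarrow> real) \<Rightarrow> nat \<Rightarrow> real"
  assumes cont: "\<And>i. i < n \<Longrightarrow> continuous_on {x. \<forall>j. x j \<in> {0..1}} (\<lambda>x. f x i)"
    and maps: "\<And>x i. \<forall>j. x j \<in> {0..1} \<Longrightarrow> i < n \<Longrightarrow> f x i \<in> {0..1}"
  shows "\<exists>x. (\<forall>j. x j \<in> {0..1}) \<and> (\<forall>i<n. f x i = x i)"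
proof -
  define C where "C = {x :: nat \<Rightarrow> real. \<forall>j. x j \<in> {0..1}}"
  have "compactin (product_topology (\<lambda>i::nat. euclidean :: real topology) UNIV) (PiE UNIV (\<lambda>_. {0..1}))"
    unfolding compactin_PiE by simp
  moreover have "PiE UNIV (\<lambda>_. {0..1}) = C"
    by (auto simp: C_def PiE_def Pi_def)
  ultimately have compC: "seq_compact C"
    by (simp add: euclidean_product_topology compactin_euclidean_iff compact_eq_seq_compact_metric)
  define sc where "sc = (\<lambda>(p::nat) (x::nat \<Rightarrow> nat) j. if j < n then real (x j) / real p else 0)"
  have "\<exists>r s :: nat \<Rightarrow> nat \<Rightarrow> real. \<exists>q. q \<in> C \<and> (\<forall>i<n. r i \<in> C \<and> s i \<in> C \<and>
          (\<forall>j. \<bar>r i j - q j\<bar> \<le> 1 / real (Suc m) \<and> \<bar>s i j - q j\<bar> \<le> 1 / real (Suc m)) \<and>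
          f (r i) i \<ge> r i i \<and> f (s i) i \<le> s i i)" for m
  proof -
    define p where "p = Suc m"
    have p: "p > 0" by (simp add: p_def)
    \<comment> \<open>Kuhn's lemma requires label 1 on upper faces and 0 on lower ones, whatever \<open>f\<close> does there.\<close>
    define lab where "lab = (\<lambda>x i. if x i = p then 1::nat else
        if x i = 0 \<or> f (sc p x) i \<ge> sc p x i then 0 else 1)"
    have scC: "sc p x \<in> C" if "\<forall>i<n. x i \<le> p" for x
      using that p by (auto simp: C_def sc_def divide_le_eq)
    obtain q where q: "\<forall>i<n. q i < p"
      and rs: "\<forall>i<n. \<exists>r s. (\<forall>j<n. q j \<le> r j \<and> r j \<le> q j + 1) \<and>
                 (\<forall>j<n. q j \<le> s j \<and> s j \<le> q j + 1) \<and> lab r i \<noteq> lab s i"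
      by (rule kuhn_lemma[OF p, of n lab]) (use p in \<open>auto simp: lab_def\<close>)
    have bd: "sc p x \<in> C \<and> (\<forall>j. \<bar>sc p x j - sc p q j\<bar> \<le> 1 / real p)"
      if "\<forall>j<n. q j \<le> x j \<and> x j \<le> q j + 1" for x
    proof
      show "sc p x \<in> C" using that q by (intro scC) fastforce
      have "\<bar>real (x j) - real (q j)\<bar> \<le> 1" if "j < n" for j
        using \<open>\<forall>j<n. q j \<le> x j \<and> x j \<le> q j + 1\<close> that by fastforce
      then have "\<bar>real (x j) / real p - real (q j) / real p\<bar> \<le> 1 / real p" if "j < n" for j
        using that p by (simp add: diff_divide_distrib[symmetric] divide_right_mono)
      then show "\<forall>j. \<bar>sc p x j - sc p q j\<bar> \<le> 1 / real p"
        by (simp add: sc_def)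
    qed
    have lab0: "f (sc p x) i \<ge> sc p x i" if "lab x i = 0" "i < n" "\<forall>i<n. x i \<le> p" for x i
    proof -
      have "f (sc p x) i \<in> {0..1}" using maps scC[OF that(3)] that(2) by (simp add: C_def)
      then show ?thesis using that p by (auto simp: lab_def sc_def split: if_splits)
    qed
    have lab1: "f (sc p x) i \<le> sc p x i" if "lab x i \<noteq> 0" "i < n" "\<forall>i<n. x i \<le> p" for x i
    proof -
      have "f (sc p x) i \<in> {0..1}" using maps scC[OF that(3)] that(2) by (simp add: C_def)
      then show ?thesis using that p by (auto simp: lab_def sc_def split: if_splits)
    qed
    have "\<exists>r s. r \<in> C \<and> s \<in> C \<and>
          (\<forall>j. \<bar>r j - sc p q j\<bar> \<le> 1 / real p \<and> \<bar>s j - sc p q j\<bar> \<le> 1 / real p) \<and>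
          f r i \<ge> r i \<and> f s i \<le> s i" if i: "i < n" for i
    proof -
      obtain r s where r: "\<forall>j<n. q j \<le> r j \<and> r j \<le> q j + 1"
        and s: "\<forall>j<n. q j \<le> s j \<and> s j \<le> q j + 1" and ne: "lab r i \<noteq> lab s i"
        using rs i by blast
      have rp: "\<forall>j<n. r j \<le> p" "\<forall>j<n. s j \<le> p" using r s q by fastforce+
      show ?thesis
      proof (cases "lab r i = 0")
        case True
        then show ?thesis using bd[OF r] bd[OF s] lab0[OF True i rp(1)] lab1[of s i] i rp ne by metis
      next
        case False
        then have "lab s i = 0" using ne by (auto simp: lab_def split: if_splits)
        then show ?thesis using bd[OF r] bd[OF s] lab1[OF False i rp(1)] lab0[of s i] i rp by metis
      qed
    qed
    then obtain r s where "\<forall>i<n. r i \<in> C \<and> s i \<in> C \<and>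
          (\<forall>j. \<bar>r i j - sc p q j\<bar> \<le> 1 / real p \<and> \<bar>s i j - sc p q j\<bar> \<le> 1 / real p) \<and>
          f (r i) i \<ge> r i i \<and> f (s i) i \<le> s i i"
      by metis
    moreover have "sc p q \<in> C" using q by (intro scC) (auto simp: less_imp_le)
    ultimately show ?thesis unfolding p_def by metis
  qed
  then obtain r s :: "nat \<Rightarrow> nat \<Rightarrow> nat \<Rightarrow> real" and q where qC: "\<And>m. q m \<in> C"
    and rs: "\<And>m i. i < n \<Longrightarrow> r m i \<in> C \<and> s m i \<in> C \<and>
          (\<forall>j. \<bar>r m i j - q m j\<bar> \<le> 1 / real (Suc m) \<and> \<bar>s m i j - q m j\<bar> \<le> 1 / real (Suc m)) \<and>
          f (r m i) i \<ge> r m i i \<and> f (s m i) i \<le> s m i i"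
    by metis
  obtain l \<sigma> where lC: "l \<in> C" and \<sigma>: "strict_mono (\<sigma> :: nat \<Rightarrow> nat)" and ql: "(q \<circ> \<sigma>) \<longlonglongrightarrow> l"
    using compC qC unfolding seq_compact_def by metis
  have coord: "(\<lambda>m. x m j) \<longlonglongrightarrow> l j" if "x \<longlonglongrightarrow> l" for x and j :: nat
    using continuous_on_tendsto_compose[OF continuous_on_product_coordinates[of j] that] by simp
  have coordI: "x \<longlonglongrightarrow> l" if "\<And>j. (\<lambda>m. x m j) \<longlonglongrightarrow> l j" for x :: "nat \<Rightarrow> nat \<Rightarrow> real"
  proof -
    have "limitin (product_topology (\<lambda>i. euclidean) UNIV) x l sequentially"
      unfolding limitin_componentwise using that by simp
    then show ?thesis by (simp add: euclidean_product_topology)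
  qed
  have near: "(\<lambda>m. x (\<sigma> m)) \<longlonglongrightarrow> l"
    if b: "\<And>m j. \<bar>x m j - q m j\<bar> \<le> 1 / real (Suc m)" for x
  proof (rule coordI)
    fix j
    have "(\<lambda>m. x m j - q m j) \<longlonglongrightarrow> 0"
      by (rule Lim_null_comparison[OF _ LIMSEQ_inverse_real_of_nat])
        (use b in \<open>auto simp: inverse_eq_divide\<close>)
    then have "(\<lambda>m. x (\<sigma> m) j - q (\<sigma> m) j) \<longlonglongrightarrow> 0"
      using LIMSEQ_subseq_LIMSEQ[OF _ \<sigma>] by (force simp: o_def)
    from tendsto_add[OF this coord[OF ql, of j]] show "(\<lambda>m. x (\<sigma> m) j) \<longlonglongrightarrow> l j"
      by (simp add: o_def)
  qed
  have "f l i = l i" if i: "i < n" for i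
  proof (rule antisym)
    have c: "continuous_on C (\<lambda>x. f x i)" using cont[OF i] by (simp add: C_def)
    have lim: "(\<lambda>m. f (x (\<sigma> m)) i) \<longlonglongrightarrow> f l i" "(\<lambda>m. x (\<sigma> m) i) \<longlonglongrightarrow> l i"
      if "\<And>m. x m \<in> C" "(\<lambda>m. x (\<sigma> m)) \<longlonglongrightarrow> l" for x
      using continuous_on_tendsto_compose[OF c that(2) lC] that(1) coord[OF that(2)] by auto
    have nr: "(\<lambda>m. r (\<sigma> m) i) \<longlonglongrightarrow> l"
      by (rule near[of "\<lambda>m. r m i"]) (use rs[OF i] in blast)
    have ns: "(\<lambda>m. s (\<sigma> m) i) \<longlonglongrightarrow> l"
      by (rule near[of "\<lambda>m. s m i"]) (use rs[OF i] in blast)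
    show "f l i \<le> l i"
      by (rule LIMSEQ_le[OF lim[of "\<lambda>m. s m i", OF _ ns]]) (use rs[OF i] in auto)
    show "l i \<le> f l i"
      by (rule LIMSEQ_le[OF lim(2,1)[of "\<lambda>m. r m i", OF _ nr]]) (use rs[OF i] in auto)
  qed
  then show ?thesis using lC by (auto simp: C_def)
qed

text \<open>The map \<open>G\<close> is unrestricted; truncating its values makes the box invariant.\<close>

lemma clamped_map_fixed_point:
  fixes G :: "(nat \<Rightarrow> real) \<Rightarrow> nat \<Rightarrow> real"
  assumes "lo < hi" and cont: "\<And>i. i < n \<Longrightarrow> continuous_on UNIV (\<lambda>p. G p i)"
  shows "\<exists>p. \<forall>i<n. max lo (min (G p i) hi) = p i"
proof -
  define S where "S = (\<lambda>(x :: nat \<Rightarrow> real) i. lo + (hi - lo) * x i)"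
  have S: "continuous_on UNIV S"
    unfolding S_def
    by (intro continuous_on_coordinatewise_then_product continuous_intros continuous_on_product_coordinates)
  define f where "f = (\<lambda>x i. (max lo (min (G (S x) i) hi) - lo) / (hi - lo))"
  have "\<exists>x. (\<forall>j. x j \<in> {0..1}) \<and> (\<forall>i<n. f x i = x i)"
  proof (rule brouwer_cube_coordinates)
    fix i assume "i < n"
    then have "continuous_on UNIV (\<lambda>x. G (S x) i)"
      using continuous_on_compose[OF S, of "\<lambda>p. G p i"] continuous_on_subset[OF cont] by (simp add: o_def)
    then have "continuous_on UNIV (\<lambda>x. f x i)"
      unfolding f_def using assms(1) by (intro continuous_intros) auto
    then show "continuous_on {x. \<forall>j. x j \<in> {0..1}} (\<lambda>x. f x i)"
      by (rule continuous_on_subset) simp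
  next
    show "f x i \<in> {0..1}" for x i
      using assms(1) by (auto simp: f_def field_simps)
  qed
  then obtain x where "\<forall>i<n. f x i = x i" by blast
  then have "\<forall>i<n. max lo (min (G (S x) i) hi) = S x i"
    using assms(1) by (simp add: f_def S_def field_simps)
  then show ?thesis by blast
qed

section \<open>Smooth functions and test functions\<close>

lemma pderiv_at_eq: "(f has_derivative f') (at x) \<Longrightarrow> pderiv_at f i x = f' (axis i 1)"
  unfolding pderiv_at_def by (metis frechet_derivative_at)

lemma pderiv_at_bounded_linear:
  assumes "bounded_linear L" "f differentiable_on UNIV"
  shows "pderiv_at (\<lambda>x. L (f x)) i = (\<lambda>x. L (pderiv_at f i x))"
proof
  fix x
  have "(f has_derivative frechet_derivative f (at x)) (at x)"
    using assms(2) by (simp add: differentiable_on_def frechet_derivative_works)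
  from pderiv_at_eq[OF bounded_linear.has_derivative[OF assms(1) this]]
  show "pderiv_at (\<lambda>x. L (f x)) i x = L (pderiv_at f i x)" by (simp add: pderiv_at_def)
qed

lemma pderiv_at_add:
  assumes "f differentiable_on UNIV" "g differentiable_on UNIV"
  shows "pderiv_at (\<lambda>x. f x + g x) i = (\<lambda>x. pderiv_at f i x + pderiv_at g i x)"
proof
  fix x
  have "(f has_derivative frechet_derivative f (at x)) (at x)"
    "(g has_derivative frechet_derivative g (at x)) (at x)"
    using assms by (simp_all add: differentiable_on_def frechet_derivative_works)
  from pderiv_at_eq[OF has_derivative_add[OF this]]
  show "pderiv_at (\<lambda>x. f x + g x) i x = pderiv_at f i x + pderiv_at g i x"
    by (simp add: pderiv_at_def)
qed

lemma pderiv_at_mult: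
  fixes f g :: "real ^ 2 \<Rightarrow> real"
  assumes "f differentiable_on UNIV" "g differentiable_on UNIV"
  shows "pderiv_at (\<lambda>x. f x * g x) i = (\<lambda>x. f x * pderiv_at g i x + pderiv_at f i x * g x)"
proof
  fix x
  have "(f has_derivative frechet_derivative f (at x)) (at x)"
    "(g has_derivative frechet_derivative g (at x)) (at x)"
    using assms by (simp_all add: differentiable_on_def frechet_derivative_works)
  from pderiv_at_eq[OF has_derivative_mult[OF this]]
  show "pderiv_at (\<lambda>x. f x * g x) i x = f x * pderiv_at g i x + pderiv_at f i x * g x"
    by (simp add: pderiv_at_def)
qed

lemma C_diff_lower: "C_diff (Suc m) f \<Longrightarrow> C_diff m f"
proof (induction m arbitrary: f)
  case 0
  then show ?case by (simp add: differentiable_imp_continuous_on)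
next
  case (Suc m)
  then show ?case by (metis C_diff.simps(2))
qed

lemma C_diff_bounded_linear:
  assumes "bounded_linear L"
  shows "C_diff m f \<Longrightarrow> C_diff m (\<lambda>x. L (f x))"
proof (induction m arbitrary: f)
  case 0
  then show ?case
    using bounded_linear.continuous_on[OF assms] by simp
next
  case (Suc m)
  then have f: "f differentiable_on UNIV" by simp
  have "(\<lambda>x. L (f x)) differentiable_on UNIV"
    using f bounded_linear.has_derivative[OF assms]
    by (fastforce simp: differentiable_on_def differentiable_def)
  then show ?case using Suc by (simp add: pderiv_at_bounded_linear[OF assms f])
qed

lemma C_diff_add: "C_diff m f \<Longrightarrow> C_diff m g \<Longrightarrow> C_diff m (\<lambda>x. f x + g x)"
proof (induction m arbitrary: f g)
  case 0
  then show ?case by (simp add: continuous_on_add)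
next
  case (Suc m)
  then show ?case by (simp add: pderiv_at_add differentiable_on_add)
qed

lemma C_diff_const: "C_diff m (\<lambda>x. c)"
proof (induction m arbitrary: c)
  case (Suc m)
  have "pderiv_at (\<lambda>x. c) i = (\<lambda>x. 0)" for i :: 2
    using pderiv_at_eq[OF has_derivative_const] by blast
  then show ?case using Suc by (simp add: differentiable_on_def)
qed simp

lemma C_diff_mult:
  fixes f g :: "real ^ 2 \<Rightarrow> real"
  shows "C_diff m f \<Longrightarrow> C_diff m g \<Longrightarrow> C_diff m (\<lambda>x. f x * g x)"
proof (induction m arbitrary: f g)
  case 0
  then show ?case by (simp add: continuous_on_mult)
next
  case (Suc m)
  then have "f differentiable_on UNIV" "g differentiable_on UNIV" "C_diff m f" "C_diff m g"
    using C_diff_lower by auto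
  then show ?case using Suc by (simp add: pderiv_at_mult differentiable_on_mult C_diff_add)
qed

lemma C_diff_prod:
  fixes f :: "'a \<Rightarrow> real ^ 2 \<Rightarrow> real"
  assumes "finite A" "\<And>a. a \<in> A \<Longrightarrow> C_diff m (f a)"
  shows "C_diff m (\<lambda>x. \<Prod>a\<in>A. f a x)"
  using assms by (induction A rule: finite_induct) (auto simp: C_diff_const C_diff_mult)

text \<open>The functions \<open>exp (- 1/t) / t\<^sup>n\<close>, extended by zero. Their span is closed under differentiation,
which makes all of them smooth; the case \<open>n = 0\<close> is the usual building block of bumps.\<close>

definition flat_exp :: "nat \<Rightarrow> real \<Rightarrow> real" where
  "flat_exp n t = (if t \<le> 0 then 0 else inverse t ^ n * exp (- inverse t))"

lemma flat_exp_tendsto_0: "((\<lambda>t. inverse t ^ n * exp (- inverse t)) \<longlongrightarrow> (0::real)) (at_right 0)"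
proof -
  have "((\<lambda>s. s ^ n / exp s) \<longlongrightarrow> (0::real)) at_top"
    by (rule tendsto_power_div_exp_0)
  from filterlim_compose[OF this filterlim_inverse_at_top_right] show ?thesis
    by (simp add: exp_minus divide_inverse)
qed

lemma flat_exp_has_derivative:
  "(flat_exp n has_real_derivative flat_exp (n + 2) t - real n * flat_exp (n + 1) t) (at t)"
proof -
  consider "t < 0" | "t > 0" | "t = 0" by linarith
  then show ?thesis
  proof cases
    case 1
    have "((\<lambda>_. 0) has_real_derivative 0) (at t)" by simp
    then have "(flat_exp n has_real_derivative 0) (at t)"
      by (rule has_field_derivative_transform_within_open[of _ _ _ "{..<0}"])
        (use 1 in \<open>auto simp: flat_exp_def\<close>)
    then show ?thesis using 1 by (simp add: flat_exp_def)
  next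
    case 2
    have "((\<lambda>t. inverse t ^ n * exp (- inverse t)) has_real_derivative
        flat_exp (n + 2) t - real n * flat_exp (n + 1) t) (at t)"
    proof (cases n)
      case 0
      then show ?thesis using 2
        by (auto intro!: derivative_eq_intros simp: flat_exp_def power2_eq_square)
    next
      case (Suc m)
      have "t * t ^ (m - Suc 0) = t ^ m \<or> m = 0"
        by (cases m) auto
      then show ?thesis using 2 Suc
        by (auto intro!: derivative_eq_intros simp: flat_exp_def field_simps)
    qed
    then show ?thesis
      by (rule has_field_derivative_transform_within_open[of _ _ _ "{0<..}"])
        (use 2 in \<open>auto simp: flat_exp_def\<close>)
  next
    case 3
    have "((\<lambda>h. flat_exp n h / h) \<longlongrightarrow> 0) (at 0)"
    proof (rule filterlim_split_at)
      show "((\<lambda>h. flat_exp n h / h) \<longlongrightarrow> 0) (at_left 0)"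
        by (rule tendsto_eventually) (auto simp: eventually_at_left_field flat_exp_def intro!: exI[of _ "-1"])
      have "eventually (\<lambda>h. inverse h ^ (n + 1) * exp (- inverse h) = flat_exp n h / h) (at_right (0::real))"
        by (auto simp: eventually_at_right_field flat_exp_def divide_inverse intro!: exI[of _ 1])
      then show "((\<lambda>h. flat_exp n h / h) \<longlongrightarrow> 0) (at_right 0)"
        by (rule Lim_transform_eventually[OF flat_exp_tendsto_0[of "n + 1"]])
    qed
    then show ?thesis using 3 by (simp add: DERIV_def flat_exp_def)
  qed
qed

text \<open>The induction runs for all \<open>n\<close> at once, as a derivative of \<open>flat_exp n\<close> is a combination of
\<open>flat_exp (n + 1)\<close> and \<open>flat_exp (n + 2)\<close>.\<close>

lemma C_diff_flat_exp_affine: "C_diff m (\<lambda>x. flat_exp n (a * x $ i + b))"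
proof (induction m arbitrary: n)
  have der: "((\<lambda>x. flat_exp n (a * x $ i + b)) has_derivative
      (\<lambda>h. (flat_exp (n + 2) (a * x $ i + b) - real n * flat_exp (n + 1) (a * x $ i + b)) * (a * h $ i))) (at x)"
    for n and x :: "real ^ 2"
  proof -
    have "((\<lambda>x::real ^ 2. a * x $ i + b) has_derivative (\<lambda>h. a * h $ i)) (at x)"
      by (intro has_derivative_add_const bounded_linear_imp_has_derivative
          bounded_linear_const_mult bounded_linear_vec_nth)
    from has_derivative_compose[OF this flat_exp_has_derivative[unfolded has_field_derivative_def]]
    show ?thesis by simp
  qed
  {
    case 0
    have "(\<lambda>x. flat_exp n (a * x $ i + b)) differentiable_on UNIV"
      using der by (auto simp: differentiable_on_def differentiable_def)
    then show ?case by (simp add: differentiable_imp_continuous_on)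
  next
    case (Suc m)
    have d: "(\<lambda>x. flat_exp n (a * x $ i + b)) differentiable_on UNIV"
      using der by (auto simp: differentiable_on_def differentiable_def)
    have p: "pderiv_at (\<lambda>x. flat_exp n (a * x $ i + b)) j =
      (\<lambda>x. (a * axis j 1 $ i) * flat_exp (n + 2) (a * x $ i + b)
         + (- (a * axis j 1 $ i * real n)) * flat_exp (n + 1) (a * x $ i + b))" for j
      by (rule ext, subst pderiv_at_eq[OF der]) (simp add: algebra_simps)
    have "C_diff m (pderiv_at (\<lambda>x. flat_exp n (a * x $ i + b)) j)" for j
      unfolding p
      by (intro C_diff_add C_diff_bounded_linear[OF bounded_linear_mult_right] Suc)
    then show ?case using d by simp
  }
qed

text \<open>For \<open>t > 0\<close> the value \<open>exp (- 1 / ((n + 1) t))\<close> increases to 1 with \<open>n\<close>. Scaling the argument thus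
yields smooth functions bounded by 1 that are positive exactly on the open box and converge
pointwise to its indicator.\<close>

definition bump :: "nat \<Rightarrow> real ^ 2 \<Rightarrow> real ^ 2 \<Rightarrow> real ^ 2 \<Rightarrow> real" where
  "bump n a b x = (\<Prod>i\<in>UNIV. flat_exp 0 (real (Suc n) * (x $ i - a $ i)) * flat_exp 0 (real (Suc n) * (b $ i - x $ i)))"

lemma flat_exp_0_bounds: "0 \<le> flat_exp 0 t" "flat_exp 0 t \<le> 1" "flat_exp 0 t = 0 \<longleftrightarrow> t \<le> 0"
  by (auto simp: flat_exp_def)

lemma bump_bounds: "0 \<le> bump n a b x" "bump n a b x \<le> 1"
  unfolding bump_def
  by (auto intro!: prod_nonneg prod_le_1 mult_nonneg_nonneg mult_le_one simp: flat_exp_0_bounds)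

lemma bump_eq_0_iff: "bump n a b x = 0 \<longleftrightarrow> x \<notin> box a b"
proof -
  have "flat_exp 0 (real (Suc n) * t) = 0 \<longleftrightarrow> t \<le> 0" for t
    by (simp add: flat_exp_0_bounds mult_le_0_iff del: of_nat_Suc)
  then show ?thesis
    unfolding bump_def mem_box_cart by (auto simp: not_less not_le simp del: of_nat_Suc)
qed

lemma bump_tendsto: "(\<lambda>n. bump n a b x) \<longlonglongrightarrow> indicator (box a b) x"
proof -
  have f: "(\<lambda>n. flat_exp 0 (real (Suc n) * t)) \<longlonglongrightarrow> (if t \<le> 0 then 0 else 1)" for t
  proof (cases "t \<le> 0")
    case True
    then have "flat_exp 0 (real (Suc n) * t) = 0" for n
      by (simp add: flat_exp_0_bounds mult_le_0_iff del: of_nat_Suc)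
    then show ?thesis using True by simp
  next
    case False
    then have "flat_exp 0 (real (Suc n) * t) = exp (- (inverse (real (Suc n)) * inverse t))" for n
      by (simp add: flat_exp_def mult_le_0_iff del: of_nat_Suc)
    moreover have "(\<lambda>n. exp (- (inverse (real (Suc n)) * inverse t))) \<longlonglongrightarrow> exp (- (0 * inverse t))"
      by (intro tendsto_intros LIMSEQ_inverse_real_of_nat)
    ultimately show ?thesis using False by simp
  qed
  have "(\<lambda>n. bump n a b x) \<longlonglongrightarrow>
      (\<Prod>i\<in>UNIV. (if x $ i - a $ i \<le> 0 then 0 else 1) * (if b $ i - x $ i \<le> 0 then 0 else 1))"
    unfolding bump_def by (intro tendsto_prod tendsto_mult f)
  also have "(\<Prod>i\<in>UNIV. (if x $ i - a $ i \<le> 0 then 0 else 1) * (if b $ i - x $ i \<le> 0 then 0 else 1))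
      = (indicator (box a b) x :: real)"
  proof (cases "x \<in> box a b")
    case True
    then have "\<not> x $ i - a $ i \<le> 0" "\<not> b $ i - x $ i \<le> 0" for i
      by (simp_all add: mem_box_cart not_le)
    then show ?thesis using True by simp
  next
    case False
    then obtain i where "x $ i - a $ i \<le> 0 \<or> b $ i - x $ i \<le> 0"
      unfolding mem_box_cart not_all de_Morgan_conj not_less diff_le_0_iff_le by blast
    then have "(if x $ i - a $ i \<le> 0 then 0 else 1) * (if b $ i - x $ i \<le> 0 then 0 else 1 :: real) = 0"
      by auto
    then have "(\<Prod>i\<in>UNIV. (if x $ i - a $ i \<le> 0 then 0 else 1) * (if b $ i - x $ i \<le> 0 then 0 else 1 :: real)) = 0"
      by (intro prod_zero bexI[of _ i]) simp_all
    then show ?thesis using False by simp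
  qed
  finally show ?thesis .
qed

lemma test_functionI:
  assumes "\<And>m. C_diff m \<psi>" "compact K" "K \<subseteq> \<Omega>" "\<And>x. x \<notin> K \<Longrightarrow> \<psi> x = 0"
  shows "test_function \<Omega> \<psi>"
proof -
  have "closure {x. \<psi> x \<noteq> 0} \<subseteq> K"
    using assms by (intro closure_minimal) (auto intro: compact_imp_closed)
  moreover from this have "compact (closure {x. \<psi> x \<noteq> 0})"
    using assms(2) compact_Int_closed[of K "closure {x. \<psi> x \<noteq> 0}"] by (simp add: Int_absorb1)
  ultimately show ?thesis using assms unfolding test_function_def by blast
qed

lemma test_functionE:
  assumes "test_function \<Omega> \<psi>"
  obtains K where "compact K" "K \<subseteq> \<Omega>" "\<And>x. x \<notin> K \<Longrightarrow> \<psi> x = 0"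
    "\<And>i x. x \<notin> K \<Longrightarrow> pderiv_at \<psi> i x = 0"
proof -
  define K where "K = closure {x. \<psi> x \<noteq> 0}"
  have z: "\<psi> x = 0" if "x \<notin> K" for x
    using that closure_subset[of "{x. \<psi> x \<noteq> 0}"] unfolding K_def by blast
  have K: "compact K" "K \<subseteq> \<Omega>"
    using assms by (simp_all add: K_def test_function_def)
  have "pderiv_at \<psi> i x = 0" if x: "x \<notin> K" for i x
  proof -
    have "((\<lambda>_. 0) has_derivative (\<lambda>_. 0)) (at x)" by simp
    moreover have "open (- K)" using K(1) by (simp add: compact_imp_closed open_Compl)
    ultimately have "(\<psi> has_derivative (\<lambda>_. 0)) (at x)"
      by (rule has_derivative_transform_within_open) (use x z in simp_all)
    from pderiv_at_eq[OF this] show ?thesis .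
  qed
  then show ?thesis using that[OF K z] by simp
qed

lemma test_function_bump: "cbox a b \<subseteq> \<Omega> \<Longrightarrow> test_function \<Omega> (bump n a b)"
proof (rule test_functionI[of _ "cbox a b"])
  have *: "bump n a b = (\<lambda>x. \<Prod>i\<in>UNIV. flat_exp 0 (real (Suc n) * x $ i + - (real (Suc n) * a $ i))
      * flat_exp 0 (- real (Suc n) * x $ i + real (Suc n) * b $ i))"
    by (rule ext) (simp add: bump_def algebra_simps)
  show "C_diff m (bump n a b)" for m
    unfolding * by (intro C_diff_prod C_diff_mult C_diff_flat_exp_affine) simp
  show "bump n a b x = 0" if "x \<notin> cbox a b" for x
    using that box_subset_cbox[of a b] by (auto simp: bump_eq_0_iff)
qed auto

lemma test_function_0: "test_function \<Omega> (\<lambda>x. 0)"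
  by (rule test_functionI[of _ "{}"]) (auto simp: C_diff_const)

lemma test_function_differentiable: "test_function \<Omega> \<psi> \<Longrightarrow> \<psi> differentiable_on UNIV"
  unfolding test_function_def by (metis C_diff.simps(2))

lemma test_function_continuous: "test_function \<Omega> \<psi> \<Longrightarrow> continuous_on UNIV \<psi>"
  unfolding test_function_def by (metis C_diff.simps(1))

lemma test_function_pderiv:
  assumes "test_function \<Omega> \<psi>"
  shows "test_function \<Omega> (pderiv_at \<psi> i)"
proof -
  obtain K where K: "compact K" "K \<subseteq> \<Omega>" "\<And>x. x \<notin> K \<Longrightarrow> \<psi> x = 0"
    "\<And>i x. x \<notin> K \<Longrightarrow> pderiv_at \<psi> i x = 0"
    by (rule test_functionE[OF assms]) blast
  have "C_diff m (pderiv_at \<psi> i)" for m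
    using assms unfolding test_function_def by (metis C_diff.simps(2))
  then show ?thesis using K by (intro test_functionI[of _ K])
qed

lemma test_function_bounded_linear:
  assumes "bounded_linear L" "test_function \<Omega> \<psi>"
  shows "test_function \<Omega> (\<lambda>x. L (\<psi> x))"
proof -
  obtain K where K: "compact K" "K \<subseteq> \<Omega>" "\<And>x. x \<notin> K \<Longrightarrow> \<psi> x = 0"
    "\<And>i x. x \<notin> K \<Longrightarrow> pderiv_at \<psi> i x = 0"
    by (rule test_functionE[OF assms(2)]) blast
  have "L 0 = 0" using assms(1) by (simp add: linear_simps)
  then show ?thesis using K assms(2)
    by (intro test_functionI[of _ K] C_diff_bounded_linear[OF assms(1)])
      (simp_all add: test_function_def)
qed

lemma test_function_add:
  assumes "test_function \<Omega> \<psi>" "test_function \<Omega> \<eta>"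
  shows "test_function \<Omega> (\<lambda>x. \<psi> x + \<eta> x)"
proof -
  obtain K where K: "compact K" "K \<subseteq> \<Omega>" "\<And>x. x \<notin> K \<Longrightarrow> \<psi> x = 0"
    "\<And>i x. x \<notin> K \<Longrightarrow> pderiv_at \<psi> i x = 0"
    by (rule test_functionE[OF assms(1)]) blast
  obtain K' where K': "compact K'" "K' \<subseteq> \<Omega>" "\<And>x. x \<notin> K' \<Longrightarrow> \<eta> x = 0"
    "\<And>i x. x \<notin> K' \<Longrightarrow> pderiv_at \<eta> i x = 0"
    by (rule test_functionE[OF assms(2)]) blast
  show ?thesis using K K' assms
    by (intro test_functionI[of _ "K \<union> K'"] C_diff_add compact_Un) (simp_all add: test_function_def)
qed

lemma test_function_bounded:
  assumes "test_function \<Omega> \<psi>"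
  obtains B where "B > 0" "\<And>x. norm (\<psi> x) \<le> B"
proof -
  obtain K where K: "compact K" "K \<subseteq> \<Omega>" "\<And>x. x \<notin> K \<Longrightarrow> \<psi> x = 0"
    "\<And>i x. x \<notin> K \<Longrightarrow> pderiv_at \<psi> i x = 0"
    by (rule test_functionE[OF assms]) blast
  have "bounded (\<psi> ` K)"
    using K(1) test_function_continuous[OF assms]
    by (intro compact_imp_bounded compact_continuous_image) (auto intro: continuous_on_subset)
  then obtain B where "B > 0" "\<And>x. x \<in> K \<Longrightarrow> norm (\<psi> x) \<le> B"
    by (auto simp: bounded_pos)
  then show ?thesis using that[of B] K(3) by (metis less_le norm_zero)
qed

section \<open>Uniqueness of weak gradients\<close>

text \<open>Lebesgue measure is complete, so measurability transfers along equality almost everywhere. If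
neither side is measurable, both integrals are 0 by convention. This lets \<open>grad\<close> be
replaced by another representative under the integral sign.\<close>

lemma set_integral_cong_AE_lebesgue:
  fixes f g :: "'a::euclidean_space \<Rightarrow> 'b::euclidean_space"
  assumes ae: "AE x in lebesgue. x \<in> A \<longrightarrow> f x = g x"
  shows "(LINT x:A|lebesgue. f x) = (LINT x:A|lebesgue. g x)"
proof -
  let ?F = "\<lambda>x. indicator A x *\<^sub>R f x" and ?G = "\<lambda>x. indicator A x *\<^sub>R g x"
  have fg: "AE x in lebesgue. ?F x = ?G x" and gf: "AE x in lebesgue. ?G x = ?F x"
    using ae by (auto simp: indicator_def elim!: eventually_mono)
  have m: "?F \<in> borel_measurable lebesgue \<longleftrightarrow> ?G \<in> borel_measurable lebesgue"
    using borel_measurable_AE[OF _ fg] borel_measurable_AE[OF _ gf] by blast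
  show "(LINT x:A|lebesgue. f x) = (LINT x:A|lebesgue. g x)"
  proof (cases "?F \<in> borel_measurable lebesgue")
    case True
    then show ?thesis
      using m fg by (auto simp: set_lebesgue_integral_def intro!: integral_cong_AE)
  next
    case False
    then have "\<not> integrable lebesgue ?F" "\<not> integrable lebesgue ?G"
      using m borel_measurable_integrable by blast+
    then show ?thesis
      by (simp add: set_lebesgue_integral_def not_integrable_integral_eq)
  qed
qed

lemma continuous_borel_measurable_lebesgue:
  fixes f :: "'a::euclidean_space \<Rightarrow> 'b::euclidean_space"
  shows "continuous_on UNIV f \<Longrightarrow> f \<in> borel_measurable lebesgue"
  by (intro measurable_completion) (simp add: borel_measurable_continuous_onI)

lemma compact_support_integrable:
  fixes f :: "'a::euclidean_space \<Rightarrow> 'b::euclidean_space"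
  assumes "compact K" "continuous_on K f" "\<And>x. x \<notin> K \<Longrightarrow> f x = 0"
  shows "integrable lborel f"
proof -
  have "integrable lborel (\<lambda>x. indicator K x *\<^sub>R f x)"
    using assms by (intro borel_integrable_compact)
  moreover have "(\<lambda>x. indicator K x *\<^sub>R f x) = f"
    using assms(3) by (auto simp: indicator_def)
  ultimately show ?thesis by simp
qed

lemma test_function_times_locally_integrable:
  fixes \<psi> :: "real ^ 2 \<Rightarrow> real"
  assumes "test_function \<Omega> \<psi>" "locally_integrable \<Omega> g"
  shows "set_integrable lebesgue \<Omega> (\<lambda>x. \<psi> x *\<^sub>R g x)"
proof -
  obtain K where K: "compact K" "K \<subseteq> \<Omega>" "\<And>x. x \<notin> K \<Longrightarrow> \<psi> x = 0"
    "\<And>i x. x \<notin> K \<Longrightarrow> pderiv_at \<psi> i x = 0"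
    by (rule test_functionE[OF assms(1)]) blast
  obtain B where B: "B > 0" "\<And>x. norm (\<psi> x) \<le> B"
    by (rule test_function_bounded[OF assms(1)]) blast
  have g: "integrable lebesgue (\<lambda>x. indicator K x *\<^sub>R g x)"
    using assms(2) K(1,2) by (simp add: locally_integrable_def set_integrable_def)
  have "integrable lebesgue (\<lambda>x. \<psi> x *\<^sub>R (indicator K x *\<^sub>R g x))"
  proof (rule Bochner_Integration.integrable_bound)
    show "integrable lebesgue (\<lambda>x. B *\<^sub>R (indicator K x *\<^sub>R g x))" by (intro integrable_scaleR_right g)
    show "(\<lambda>x. \<psi> x *\<^sub>R (indicator K x *\<^sub>R g x)) \<in> borel_measurable lebesgue"
      using continuous_borel_measurable_lebesgue[OF test_function_continuous[OF assms(1)]]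
        borel_measurable_integrable[OF g] by (rule borel_measurable_scaleR)
    show "AE x in lebesgue. norm (\<psi> x *\<^sub>R (indicator K x *\<^sub>R g x)) \<le> norm (B *\<^sub>R (indicator K x *\<^sub>R g x))"
      using B by (intro always_eventually allI) (auto simp: abs_mult intro!: mult_right_mono)
  qed
  moreover have "(\<lambda>x. \<psi> x *\<^sub>R (indicator K x *\<^sub>R g x)) = (\<lambda>x. indicator \<Omega> x *\<^sub>R (\<psi> x *\<^sub>R g x))"
  proof
    show "\<psi> x *\<^sub>R (indicator K x *\<^sub>R g x) = indicator \<Omega> x *\<^sub>R (\<psi> x *\<^sub>R g x)" for x
      using K(2,3) by (cases "x \<in> K") auto
  qed
  ultimately show ?thesis unfolding set_integrable_def by (simp only:)
qed

lemma locally_integrable_bounded_linear: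
  assumes "bounded_linear L" "locally_integrable \<Omega> f"
  shows "locally_integrable \<Omega> (\<lambda>x. L (f x))"
proof -
  interpret L: bounded_linear L by fact
  show ?thesis
    using assms(2) integrable_bounded_linear[OF assms(1)]
    unfolding locally_integrable_def set_integrable_def L.scaleR[symmetric] by blast
qed

lemma locally_integrable_add:
  "locally_integrable \<Omega> f \<Longrightarrow> locally_integrable \<Omega> g \<Longrightarrow> locally_integrable \<Omega> (\<lambda>x. f x + g x)"
  unfolding locally_integrable_def by (simp add: set_integral_add(1))

lemma locally_integrable_const: "locally_integrable \<Omega> (\<lambda>x. c)"
proof -
  have "integrable lebesgue (\<lambda>x. indicator C x *\<^sub>R c)" if "compact C" for C :: "(real ^ 2) set"
    using borel_integrable_compact[OF that, of "\<lambda>_. c"] by (simp add: integrable_completion)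
  then show ?thesis by (simp add: locally_integrable_def set_integrable_def)
qed

text \<open>Dominated convergence along the bumps shows that \<open>h\<close> has integral 0 over every box whose closure lies
in \<open>\<Omega>\<close>. On a closed box in \<open>\<Omega>\<close>, Lebesgue differentiation recovers \<open>h\<close> almost everywhere from its
integrals over small cubes, so it vanishes there; countably many closed boxes exhaust \<open>\<Omega>\<close>.\<close>

lemma fundamental_lemma_variations:
  fixes h :: "real ^ 2 \<Rightarrow> 'b::euclidean_space"
  assumes "open \<Omega>" and li: "locally_integrable \<Omega> h"
    and zero: "\<And>\<psi> :: real ^ 2 \<Rightarrow> real. test_function \<Omega> \<psi> \<Longrightarrow> (LINT x:\<Omega>|lebesgue. \<psi> x *\<^sub>R h x) = 0"
  shows "AE x in lebesgue. x \<in> \<Omega> \<longrightarrow> h x = 0"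
proof -
  have box: "(LINT x|lebesgue. indicator (box a b) x *\<^sub>R h x) = 0" if ab: "cbox a b \<subseteq> \<Omega>" for a b
  proof -
    have g: "integrable lebesgue (\<lambda>x. indicator (cbox a b) x *\<^sub>R h x)"
      using li ab by (simp add: locally_integrable_def set_integrable_def)
    have t: "test_function \<Omega> (bump n a b)" for n using ab by (rule test_function_bump)
    have s: "set_integrable lebesgue \<Omega> (\<lambda>x. bump n a b x *\<^sub>R h x)" for n
      using t li by (rule test_function_times_locally_integrable)
    have "set_integrable lebesgue (box a b) h"
      by (rule set_integrable_subset[of _ "cbox a b"])
        (use g box_subset_cbox[of a b] in \<open>auto simp: set_integrable_def\<close>)
    then have m: "(\<lambda>x. indicator (box a b) x *\<^sub>R h x) \<in> borel_measurable lebesgue"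
      unfolding set_integrable_def by (rule borel_measurable_integrable)
    have "(\<lambda>n. LINT x|lebesgue. indicator \<Omega> x *\<^sub>R (bump n a b x *\<^sub>R h x))
        \<longlonglongrightarrow> (LINT x|lebesgue. indicator (box a b) x *\<^sub>R h x)"
    proof (rule integral_dominated_convergence[where w = "\<lambda>x. norm (indicator (cbox a b) x *\<^sub>R h x)"])
      show "AE x in lebesgue. (\<lambda>n. indicator \<Omega> x *\<^sub>R (bump n a b x *\<^sub>R h x))
          \<longlonglongrightarrow> indicator (box a b) x *\<^sub>R h x"
      proof (intro always_eventually allI)
        fix x
        have "indicator \<Omega> x *\<^sub>R (indicator (box a b) x *\<^sub>R h x) = indicator (box a b) x *\<^sub>R h x"
          using ab box_subset_cbox[of a b] by (auto simp: indicator_def)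
        moreover have "(\<lambda>n. indicator \<Omega> x *\<^sub>R (bump n a b x *\<^sub>R h x))
            \<longlonglongrightarrow> indicator \<Omega> x *\<^sub>R (indicator (box a b) x *\<^sub>R h x)"
          by (intro tendsto_intros bump_tendsto)
        ultimately show "(\<lambda>n. indicator \<Omega> x *\<^sub>R (bump n a b x *\<^sub>R h x))
          \<longlonglongrightarrow> indicator (box a b) x *\<^sub>R h x" by (simp only:)
      qed
      show "AE x in lebesgue. norm (indicator \<Omega> x *\<^sub>R (bump n a b x *\<^sub>R h x))
          \<le> norm (indicator (cbox a b) x *\<^sub>R h x)" for n
      proof (intro always_eventually allI)
        fix x
        show "norm (indicator \<Omega> x *\<^sub>R (bump n a b x *\<^sub>R h x)) \<le> norm (indicator (cbox a b) x *\<^sub>R h x)"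
        proof (cases "x \<in> cbox a b")
          case True
          have "\<bar>bump n a b x\<bar> * norm (h x) \<le> 1 * norm (h x)"
            using bump_bounds[of n a b x] by (intro mult_right_mono) auto
          then show ?thesis using True by (simp add: indicator_def)
        next
          case False
          then have "x \<notin> box a b" using box_subset_cbox by blast
          then have "bump n a b x = 0" by (simp add: bump_eq_0_iff)
          then show ?thesis by simp
        qed
      qed
      show "(\<lambda>x. indicator \<Omega> x *\<^sub>R (bump n a b x *\<^sub>R h x)) \<in> borel_measurable lebesgue" for n
        using s[of n] unfolding set_integrable_def by (rule borel_measurable_integrable)
      show "integrable lebesgue (\<lambda>x. norm (indicator (cbox a b) x *\<^sub>R h x))"
        using g by (rule integrable_norm)
    qed (rule m)
    moreover have "(LINT x|lebesgue. indicator \<Omega> x *\<^sub>R (bump n a b x *\<^sub>R h x)) = 0" for n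
      using zero[OF t[of n]] by (simp add: set_lebesgue_integral_def)
    ultimately show ?thesis by (simp add: LIMSEQ_const_iff)
  qed
  have "AE x in lebesgue. x \<in> cbox c d \<longrightarrow> h x = 0" if cd: "cbox c d \<subseteq> \<Omega>" for c d
  proof -
    define F where "F = (\<lambda>x. indicator (cbox c d) x *\<^sub>R h x)"
    have F: "integrable lebesgue F"
      using li cd by (simp add: locally_integrable_def set_integrable_def F_def)
    have Fabs: "F absolutely_integrable_on cbox a b" for a b
      unfolding set_integrable_def by (rule integrable_mult_indicator[OF _ F]) simp
    then have "F integrable_on cbox a b" for a b by (rule set_lebesgue_integral_eq_integral(1))
    then obtain N where N: "negligible N" "\<And>x e. x \<notin> N \<Longrightarrow> 0 < e \<Longrightarrow>
               \<exists>\<delta>>0. \<forall>t. 0 < t \<and> t < \<delta> \<longrightarrow>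
                         norm(integral (cbox x (x + t *\<^sub>R One)) F /\<^sub>R t ^ DIM(real ^ 2) - F x) < e"
      by (rule integrable_ccontinuous_explicit[of F]) blast
    have h0: "h x = 0" if x: "x \<notin> N" "x \<in> box c d" for x
    proof (rule ccontr)
      assume "h x \<noteq> 0"
      then have "0 < norm (h x)" by simp
      from N(2)[OF x(1) this] obtain \<delta> where \<delta>: "\<delta> > 0" "\<And>t. 0 < t \<Longrightarrow> t < \<delta> \<Longrightarrow>
        norm(integral (cbox x (x + t *\<^sub>R One)) F /\<^sub>R t ^ DIM(real ^ 2) - F x) < norm (h x)" by blast
      have "open (box c d)" by (rule open_box)
      then obtain e where e: "e > 0" "cball x e \<subseteq> box c d"
        using x(2) open_contains_cball by blast
      \<comment> \<open>A cube of side \<open>t\<close> with corner \<open>x\<close> has diameter at most \<open>e\<close>, so it stays in the box.\<close>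
      define t where "t = min (\<delta> / 2) (e / (1 + norm (One :: real ^ 2)))"
      have n1: "1 + norm (One :: real ^ 2) > 0" by (simp add: add_pos_nonneg)
      have t: "0 < t" "t < \<delta>" "t \<le> e / (1 + norm (One :: real ^ 2))"
        using \<delta>(1) e(1) n1 by (auto simp: t_def)
      have "t * norm (One :: real ^ 2) \<le> t * (1 + norm (One :: real ^ 2))"
        using t(1) by (intro mult_left_mono) auto
      also have "\<dots> \<le> e" using t(3) n1 by (simp add: pos_le_divide_eq)
      finally have tn: "t * norm (One :: real ^ 2) \<le> e" .
      have "x + t *\<^sub>R One \<in> cball x e" using tn t(1) by (simp add: dist_norm)
      then have mem: "x + t *\<^sub>R One \<in> cbox c d" "x \<in> cbox c d"
        using e(2) x(2) box_subset_cbox[of c d] by blast+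
      then have sub: "cbox x (x + t *\<^sub>R One) \<subseteq> cbox c d"
        by (simp add: subset_box mem_box)
      have "integral (cbox x (x + t *\<^sub>R One)) F = integral (box x (x + t *\<^sub>R One)) F"
        by (simp add: integral_open_interval)
      also have "\<dots> = (LINT y:box x (x + t *\<^sub>R One)|lebesgue. F y)"
      proof (rule set_lebesgue_integral_eq_integral(2)[symmetric])
        show "F absolutely_integrable_on box x (x + t *\<^sub>R One)"
          unfolding set_integrable_def by (rule integrable_mult_indicator[OF _ F]) simp
      qed
      also have "\<dots> = (LINT y|lebesgue. indicator (box x (x + t *\<^sub>R One)) y *\<^sub>R h y)"
        unfolding set_lebesgue_integral_def F_def
        using sub box_subset_cbox[of x "x + t *\<^sub>R One"]
        by (intro Bochner_Integration.integral_cong) (auto simp: indicator_def)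
      also have "\<dots> = 0" using sub cd by (intro box) blast
      finally have "norm (F x) < norm (h x)" using \<delta>(2)[OF t(1,2)] by simp
      then show False using mem(2) by (simp add: F_def)
    qed
    have "negligible (N \<union> (cbox c d - box c d))"
      using N(1) negligible_frontier_interval by (rule negligible_Un)
    then have "AE x in lebesgue. x \<notin> N \<union> (cbox c d - box c d)"
      by (intro AE_not_in) (simp add: negligible_iff_null_sets)
    then show ?thesis by eventually_elim (use h0 in blast)
  qed
  note local = this
  obtain \<D> where D: "countable \<D>" "\<And>X. X \<in> \<D> \<Longrightarrow> X \<subseteq> \<Omega>" "\<And>X. X \<in> \<D> \<Longrightarrow> \<exists>a b. X = cbox a b" "\<Union>\<D> = \<Omega>"
    by (rule open_countable_Union_open_cbox[OF assms(1)]) blast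
  have "AE x in lebesgue. \<forall>X\<in>\<D>. x \<in> X \<longrightarrow> h x = 0"
    unfolding AE_ball_countable[OF D(1)]
  proof
    fix X assume X: "X \<in> \<D>"
    then obtain a b where "X = cbox a b" using D(3) by blast
    then show "AE x in lebesgue. x \<in> X \<longrightarrow> h x = 0" using local D(2)[OF X] by simp
  qed
  then show ?thesis by eventually_elim (use D(4) in blast)
qed

lemma has_weak_gradientD:
  assumes "has_weak_gradient \<Omega> f g"
  shows "locally_integrable \<Omega> f" and "locally_integrable \<Omega> g"
    and "test_function \<Omega> \<psi> \<Longrightarrow>
        (LINT x:\<Omega>|lebesgue. pderiv_at \<psi> i x *\<^sub>R f x) = - (LINT x:\<Omega>|lebesgue. \<psi> x *\<^sub>R (g x $ i))"
  using assms unfolding has_weak_gradient_def by blast+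

lemma weak_gradient_unique:
  assumes "open \<Omega>" "has_weak_gradient \<Omega> f g" "has_weak_gradient \<Omega> f g'"
  shows "AE x in lebesgue. x \<in> \<Omega> \<longrightarrow> g x = g' x"
proof -
  have "AE x in lebesgue. x \<in> \<Omega> \<longrightarrow> g x $ i + - 1 *\<^sub>R (g' x $ i) = 0" for i
  proof (rule fundamental_lemma_variations[OF assms(1)])
    note l = assms(2,3)[THEN has_weak_gradientD(2),
        THEN locally_integrable_bounded_linear[OF bounded_linear_vec_nth[of i]]]
    show "locally_integrable \<Omega> (\<lambda>x. g x $ i + - 1 *\<^sub>R (g' x $ i))"
    proof (rule locally_integrable_add[OF l(1)])
      show "locally_integrable \<Omega> (\<lambda>x. - 1 *\<^sub>R (g' x $ i))"
        using bounded_linear_scaleR_right l(2) by (rule locally_integrable_bounded_linear)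
    qed
    fix \<psi> :: "real ^ 2 \<Rightarrow> real" assume t: "test_function \<Omega> \<psi>"
    have "(LINT x:\<Omega>|lebesgue. \<psi> x *\<^sub>R (g x $ i)) = (LINT x:\<Omega>|lebesgue. \<psi> x *\<^sub>R (g' x $ i))"
      using has_weak_gradientD(3)[OF assms(2) t, of i, symmetric]
        has_weak_gradientD(3)[OF assms(3) t, of i, symmetric]
      by (rule neg_equal_iff_equal[THEN iffD1, OF trans, OF _ sym])
    moreover have "(LINT x:\<Omega>|lebesgue. \<psi> x *\<^sub>R (g x $ i) - \<psi> x *\<^sub>R (g' x $ i))
        = (LINT x:\<Omega>|lebesgue. \<psi> x *\<^sub>R (g x $ i)) - (LINT x:\<Omega>|lebesgue. \<psi> x *\<^sub>R (g' x $ i))"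
      by (intro set_integral_diff(2) test_function_times_locally_integrable[OF t] l)
    ultimately have "(LINT x:\<Omega>|lebesgue. \<psi> x *\<^sub>R (g x $ i) - \<psi> x *\<^sub>R (g' x $ i)) = 0"
      by (simp only: diff_self)
    then show "(LINT x:\<Omega>|lebesgue. \<psi> x *\<^sub>R (g x $ i + - 1 *\<^sub>R (g' x $ i))) = 0"
      by (simp add: scaleR_diff_right)
  qed
  then have "AE x in lebesgue. \<forall>i\<in>UNIV. x \<in> \<Omega> \<longrightarrow> g x $ i + - 1 *\<^sub>R (g' x $ i) = 0"
    by (intro AE_finite_allI) simp_all
  then show ?thesis by eventually_elim (simp add: vec_eq_iff)
qed

lemma grad_AE_eq:
  assumes "open \<Omega>" "has_weak_gradient \<Omega> f g"
  shows "AE x in lebesgue. x \<in> \<Omega> \<longrightarrow> grad \<Omega> f x = g x"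
  using weak_gradient_unique[OF assms(1) _ assms(2)] someI[of "has_weak_gradient \<Omega> f", OF assms(2)]
  unfolding grad_def by blast

text \<open>The integral of \<open>\<psi>\<close> is invariant under translation, so all its difference quotients have integral 0.
They converge to the partial derivative, dominated by a bound for that derivative on a ball
containing the support and its translates by vectors of norm at most 1.\<close>

lemma integral_pderiv_test_function:
  fixes \<psi> :: "real ^ 2 \<Rightarrow> real"
  assumes "test_function \<Omega> \<psi>"
  shows "(LINT x|lborel. pderiv_at \<psi> i x) = 0"
proof -
  obtain K where K: "compact K" "K \<subseteq> \<Omega>" "\<And>x. x \<notin> K \<Longrightarrow> \<psi> x = 0"
    "\<And>i x. x \<notin> K \<Longrightarrow> pderiv_at \<psi> i x = 0"
    by (rule test_functionE[OF assms]) blast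
  obtain R where R: "K \<subseteq> cball 0 R" using compact_imp_bounded[OF K(1)] by (auto simp: bounded_iff subset_iff)
  obtain B where B: "B > 0" "\<And>x. norm (pderiv_at \<psi> i x) \<le> B"
    by (rule test_function_bounded[OF test_function_pderiv[OF assms, of i]]) blast
  define e where "e = (axis i 1 :: real ^ 2)"
  have ne: "norm e = 1" by (simp add: e_def norm_axis_1)
  have cont: "continuous_on UNIV \<psi>" by (rule test_function_continuous[OF assms])
  have meas: "\<psi> \<in> borel_measurable borel" using cont by (rule borel_measurable_continuous_onI)
  have der: "((\<lambda>t. \<psi> (x + t *\<^sub>R e)) has_real_derivative pderiv_at \<psi> i (x + t *\<^sub>R e)) (at t)" for x t
  proof -
    have d: "(\<psi> has_derivative frechet_derivative \<psi> (at (x + t *\<^sub>R e))) (at (x + t *\<^sub>R e))"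
      using test_function_differentiable[OF assms] by (simp add: differentiable_on_def frechet_derivative_works)
    have a: "((\<lambda>t. x + t *\<^sub>R e) has_derivative (\<lambda>s. s *\<^sub>R e)) (at t)"
      by (auto intro!: derivative_eq_intros)
    have "((\<lambda>t. \<psi> (x + t *\<^sub>R e)) has_derivative (\<lambda>s. frechet_derivative \<psi> (at (x + t *\<^sub>R e)) (s *\<^sub>R e))) (at t)"
      by (rule has_derivative_compose[OF a d])
    moreover have "frechet_derivative \<psi> (at (x + t *\<^sub>R e)) (s *\<^sub>R e) = pderiv_at \<psi> i (x + t *\<^sub>R e) * s" for s
      using linear_scale[OF bounded_linear.linear[OF has_derivative_bounded_linear[OF d]], of s e]
      by (simp add: pderiv_at_def e_def)
    ultimately show ?thesis by (simp add: has_field_derivative_def)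
  qed
  define D where "D = (\<lambda>n x. (\<psi> (x + inverse (real (Suc n)) *\<^sub>R e) - \<psi> x) / inverse (real (Suc n)))"
  have intpsi: "integrable lborel \<psi>"
    by (rule compact_support_integrable[OF K(1) _ K(3)]) (use cont continuous_on_subset in blast)
  have intshift: "integrable lborel (\<lambda>x. \<psi> (x + v))" "(LINT x|lborel. \<psi> (x + v)) = (LINT x|lborel. \<psi> x)" for v
  proof -
    have "lborel = distr lborel borel (\<lambda>x. v + x)" by (rule lborel_distr_plus[symmetric])
    then have *: "integrable (distr lborel borel (\<lambda>x. v + x)) \<psi>"
      "(LINT x|lborel. \<psi> x) = (LINT x|distr lborel borel (\<lambda>x. v + x). \<psi> x)"
      using intpsi by simp_all
    show "integrable lborel (\<lambda>x. \<psi> (x + v))"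
      using *(1) meas by (subst (asm) integrable_distr_eq) (simp_all add: add.commute)
    show "(LINT x|lborel. \<psi> (x + v)) = (LINT x|lborel. \<psi> x)"
      unfolding *(2) using meas by (subst integral_distr) (simp_all add: add.commute)
  qed
  have D0: "(LINT x|lborel. D n x) = 0" for n
    unfolding D_def using intshift intpsi by simp
  have "(\<lambda>n. LINT x|lborel. D n x) \<longlonglongrightarrow> (LINT x|lborel. pderiv_at \<psi> i x)"
  proof (rule integral_dominated_convergence[where w = "\<lambda>x. B * indicator (cball 0 (R + 1)) x"])
    show "pderiv_at \<psi> i \<in> borel_measurable lborel"
      using test_function_continuous[OF test_function_pderiv[OF assms]]
      by (simp add: borel_measurable_continuous_onI)
    show "D n \<in> borel_measurable lborel" for n
      unfolding D_def using meas intshift(1)[THEN borel_measurable_integrable] by measurable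
    show "integrable lborel (\<lambda>x :: real ^ 2. B * indicator (cball 0 (R + 1)) x)"
      using emeasure_bounded_finite[of "cball (0 :: real ^ 2) (R + 1)"]
      by (intro integrable_mult_right) (simp add: integrable_indicator_iff)
    show "AE x in lborel. (\<lambda>n. D n x) \<longlonglongrightarrow> pderiv_at \<psi> i x"
    proof (intro always_eventually allI)
      fix x
      have "((\<lambda>h. (\<psi> (x + (0 + h) *\<^sub>R e) - \<psi> (x + 0 *\<^sub>R e)) / h) \<longlongrightarrow> pderiv_at \<psi> i (x + 0 *\<^sub>R e)) (at 0)"
        using der[of x 0] by (simp only: DERIV_def)
      moreover have "filterlim (\<lambda>n. inverse (real (Suc n))) (at 0) sequentially"
        using LIMSEQ_inverse_real_of_nat by (simp add: filterlim_at)
      ultimately have "((\<lambda>n. (\<psi> (x + (0 + inverse (real (Suc n))) *\<^sub>R e) - \<psi> (x + 0 *\<^sub>R e)) / inverse (real (Suc n)))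
          \<longlongrightarrow> pderiv_at \<psi> i (x + 0 *\<^sub>R e)) sequentially"
        by (rule filterlim_compose)
      then show "(\<lambda>n. D n x) \<longlonglongrightarrow> pderiv_at \<psi> i x" by (simp add: D_def)
    qed
    show "AE x in lborel. norm (D n x) \<le> B * indicator (cball 0 (R + 1)) x" for n
    proof (intro always_eventually allI)
      fix x
      define s where "s = inverse (real (Suc n))"
      have s: "0 < s" "s \<le> 1" by (auto simp: s_def inverse_le_1_iff)
      have nD: "norm (D n x) = \<bar>\<psi> (x + s *\<^sub>R e) - \<psi> x\<bar> / s"
        using s(1) unfolding D_def s_def[symmetric] by simp
      show "norm (D n x) \<le> B * indicator (cball 0 (R + 1)) x"
      proof (cases "x \<in> cball 0 (R + 1)")
        case True
        obtain z where z: "\<psi> (x + s *\<^sub>R e) - \<psi> (x + 0 *\<^sub>R e) = (s - 0) * pderiv_at \<psi> i (x + z *\<^sub>R e)"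
          using MVT2[OF s(1), of "\<lambda>t. \<psi> (x + t *\<^sub>R e)" "\<lambda>t. pderiv_at \<psi> i (x + t *\<^sub>R e)"] der by blast
        then have "\<bar>\<psi> (x + s *\<^sub>R e) - \<psi> x\<bar> / s = norm (pderiv_at \<psi> i (x + z *\<^sub>R e))"
          using s(1) by (simp add: abs_mult)
        then show ?thesis using B(2) nD True by simp
      next
        case False
        have "norm x \<le> norm (x + s *\<^sub>R e) + norm (s *\<^sub>R e)"
          using norm_triangle_ineq4[of "x + s *\<^sub>R e" "s *\<^sub>R e"] by simp
        then have "x + s *\<^sub>R e \<notin> cball 0 R" "x \<notin> cball 0 R"
          using False s ne by auto
        then have "\<psi> (x + s *\<^sub>R e) = 0" "\<psi> x = 0" using K(3) R by blast+
        then show ?thesis using nD False by simp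
      qed
    qed
  qed
  then show ?thesis using D0 by (simp add: LIMSEQ_const_iff)
qed

lemma has_weak_gradient_const: "has_weak_gradient \<Omega> (\<lambda>x. c) (\<lambda>x. 0)"
proof -
  have "(LINT x:\<Omega>|lebesgue. pderiv_at \<psi> i x *\<^sub>R c) = 0"
    if t: "test_function \<Omega> \<psi>" for \<psi> :: "real ^ 2 \<Rightarrow> real" and i
  proof -
    obtain K where K: "compact K" "K \<subseteq> \<Omega>" "\<And>x. x \<notin> K \<Longrightarrow> \<psi> x = 0"
      "\<And>i x. x \<notin> K \<Longrightarrow> pderiv_at \<psi> i x = 0"
      by (rule test_functionE[OF t]) blast
    have c: "continuous_on UNIV (pderiv_at \<psi> i)"
      by (rule test_function_continuous[OF test_function_pderiv[OF t]])
    have int: "integrable lborel (pderiv_at \<psi> i)"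
      by (rule compact_support_integrable[OF K(1) _ K(4)]) (use c continuous_on_subset in blast)
    have "(LINT x:\<Omega>|lebesgue. pderiv_at \<psi> i x *\<^sub>R c) = (LINT x|lebesgue. pderiv_at \<psi> i x *\<^sub>R c)"
      unfolding set_lebesgue_integral_def
      using K(2,4) by (intro Bochner_Integration.integral_cong) (auto simp: indicator_def)
    also have "\<dots> = (LINT x|lborel. pderiv_at \<psi> i x *\<^sub>R c)"
      using borel_measurable_continuous_onI[OF c] by (intro integral_completion) simp
    also have "\<dots> = 0"
      using int integral_pderiv_test_function[OF t] by simp
    finally show ?thesis .
  qed
  then show ?thesis
    unfolding has_weak_gradient_def by (simp add: locally_integrable_const set_lebesgue_integral_def)
qed

section \<open>Linear structure of the Sobolev space with zero trace\<close>

lemma square_integrable_dominated: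
  fixes f :: "real ^ 2 \<Rightarrow> 'b::euclidean_space" and b :: "real ^ 2 \<Rightarrow> real"
  assumes "set_borel_measurable lebesgue \<Omega> f" "set_integrable lebesgue \<Omega> b"
    and "\<And>x. x \<in> \<Omega> \<Longrightarrow> (norm (f x))\<^sup>2 \<le> b x"
  shows "square_integrable \<Omega> f"
  unfolding square_integrable_def
proof (rule conjI[OF assms(1)])
  have m: "(\<lambda>x. indicator \<Omega> x *\<^sub>R f x) \<in> borel_measurable lebesgue"
    using assms(1) by (simp add: set_borel_measurable_def)
  have "(\<lambda>x. (norm (indicator \<Omega> x *\<^sub>R f x))\<^sup>2) \<in> borel_measurable lebesgue"
    using m by measurable
  moreover have eq: "(norm (indicator \<Omega> x *\<^sub>R f x))\<^sup>2 = indicator \<Omega> x *\<^sub>R (norm (f x))\<^sup>2" for x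
    by (simp add: indicator_def)
  ultimately have "(\<lambda>x. indicator \<Omega> x *\<^sub>R (norm (f x))\<^sup>2) \<in> borel_measurable lebesgue"
    by simp
  then show "set_integrable lebesgue \<Omega> (\<lambda>x. (norm (f x))\<^sup>2)"
    unfolding set_integrable_def
  proof (rule Bochner_Integration.integrable_bound[OF assms(2)[unfolded set_integrable_def]])
    show "AE x in lebesgue. norm (indicator \<Omega> x *\<^sub>R (norm (f x))\<^sup>2) \<le> norm (indicator \<Omega> x *\<^sub>R b x)"
      using assms(3) by (intro always_eventually allI) (force simp: indicator_def)
  qed
qed

lemma norm_add_squared_le: "(norm (a + b))\<^sup>2 \<le> 2 * (norm a)\<^sup>2 + 2 * (norm b)\<^sup>2"
  for a b :: "'b::real_normed_vector"
proof -
  have "(norm (a + b))\<^sup>2 \<le> (norm a + norm b)\<^sup>2"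
    by (intro power_mono norm_triangle_ineq) simp
  also have "\<dots> \<le> 2 * (norm a)\<^sup>2 + 2 * (norm b)\<^sup>2"
    using zero_le_power2[of "norm a - norm b"] by (simp add: power2_eq_square algebra_simps)
  finally show ?thesis .
qed

lemma square_integrable_add:
  assumes "square_integrable \<Omega> f" "square_integrable \<Omega> g"
  shows "square_integrable \<Omega> (\<lambda>x. f x + g x)"
proof (rule square_integrable_dominated)
  show "set_borel_measurable lebesgue \<Omega> (\<lambda>x. f x + g x)"
    using assms borel_measurable_add
    unfolding square_integrable_def set_borel_measurable_def scaleR_add_right by blast
  show "set_integrable lebesgue \<Omega> (\<lambda>x. 2 * (norm (f x))\<^sup>2 + 2 * (norm (g x))\<^sup>2)"
    using assms unfolding square_integrable_def by (simp add: set_integral_add(1))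
qed (rule norm_add_squared_le)

lemma square_integrable_bounded_linear:
  fixes f :: "real ^ 2 \<Rightarrow> 'b::euclidean_space" and L :: "'b \<Rightarrow> 'c::euclidean_space"
  assumes "bounded_linear L" "square_integrable \<Omega> f"
  shows "square_integrable \<Omega> (\<lambda>x. L (f x))"
proof -
  interpret L: bounded_linear L by fact
  show ?thesis
  proof (rule square_integrable_dominated)
    have "(\<lambda>x. indicator \<Omega> x *\<^sub>R f x) \<in> borel_measurable lebesgue"
      using assms(2) by (simp add: square_integrable_def set_borel_measurable_def)
    then have "(\<lambda>x. L (indicator \<Omega> x *\<^sub>R f x)) \<in> borel_measurable lebesgue"
      by (rule measurable_compose) (rule borel_measurable_continuous_onI, rule L.continuous_on, rule continuous_on_id)
    then show "set_borel_measurable lebesgue \<Omega> (\<lambda>x. L (f x))"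
      by (simp add: set_borel_measurable_def L.scaleR)
    show "set_integrable lebesgue \<Omega> (\<lambda>x. (onorm L)\<^sup>2 * (norm (f x))\<^sup>2)"
      using assms(2) unfolding square_integrable_def by simp
    show "(norm (L (f x)))\<^sup>2 \<le> (onorm L)\<^sup>2 * (norm (f x))\<^sup>2" for x
      unfolding power_mult_distrib[symmetric]
      by (intro power_mono onorm assms(1)) simp
  qed
qed

lemma square_integrable_diff:
  assumes "square_integrable \<Omega> f" "square_integrable \<Omega> g"
  shows "square_integrable \<Omega> (\<lambda>x. f x - g x)"
  using square_integrable_add[OF assms(1)
      square_integrable_bounded_linear[OF bounded_linear_minus[OF bounded_linear_ident] assms(2)]]
  by simp

lemma square_integrable_inner:
  fixes f g :: "real ^ 2 \<Rightarrow> 'b::euclidean_space"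
  assumes "square_integrable \<Omega> f" "square_integrable \<Omega> g"
  shows "set_integrable lebesgue \<Omega> (\<lambda>x. f x \<bullet> g x)"
  unfolding set_integrable_def
proof (rule Bochner_Integration.integrable_bound)
  show "integrable lebesgue (\<lambda>x. indicator \<Omega> x *\<^sub>R (norm (f x))\<^sup>2 + indicator \<Omega> x *\<^sub>R (norm (g x))\<^sup>2)"
    using assms unfolding square_integrable_def set_integrable_def by (intro Bochner_Integration.integrable_add) blast+
  have "(\<lambda>x. indicator \<Omega> x *\<^sub>R f x) \<in> borel_measurable lebesgue" "(\<lambda>x. indicator \<Omega> x *\<^sub>R g x) \<in> borel_measurable lebesgue"
    using assms unfolding square_integrable_def set_borel_measurable_def by blast+
  then have "(\<lambda>x. (indicator \<Omega> x *\<^sub>R f x) \<bullet> (indicator \<Omega> x *\<^sub>R g x)) \<in> borel_measurable lebesgue"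
    by (rule borel_measurable_inner)
  moreover have "(\<lambda>x. (indicator \<Omega> x *\<^sub>R f x) \<bullet> (indicator \<Omega> x *\<^sub>R g x)) = (\<lambda>x. indicator \<Omega> x *\<^sub>R (f x \<bullet> g x))"
    by (auto simp: indicator_def)
  ultimately show "(\<lambda>x. indicator \<Omega> x *\<^sub>R (f x \<bullet> g x)) \<in> borel_measurable lebesgue" by simp
  have "\<bar>a \<bullet> b\<bar> \<le> (norm a)\<^sup>2 + (norm b)\<^sup>2" for a b :: 'b
  proof -
    have "\<bar>a \<bullet> b\<bar> \<le> norm a * norm b" by (rule Cauchy_Schwarz_ineq2)
    also have "\<dots> \<le> (norm a)\<^sup>2 + (norm b)\<^sup>2"
      using zero_le_power2[of "norm a - norm b"] zero_le_power2[of "norm a"] zero_le_power2[of "norm b"]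
      unfolding power2_diff by linarith
    finally show ?thesis .
  qed
  then show "AE x in lebesgue. norm (indicator \<Omega> x *\<^sub>R (f x \<bullet> g x))
      \<le> norm (indicator \<Omega> x *\<^sub>R (norm (f x))\<^sup>2 + indicator \<Omega> x *\<^sub>R (norm (g x))\<^sup>2)"
    by (intro always_eventually allI) (simp add: indicator_def)
qed

lemma square_integrable_compact_support:
  fixes F :: "real ^ 2 \<Rightarrow> 'b::euclidean_space"
  assumes "open \<Omega>" "continuous_on UNIV F" "compact K" "\<And>x. x \<notin> K \<Longrightarrow> F x = 0"
  shows "square_integrable \<Omega> F"
proof -
  have s: "\<Omega> \<in> sets lebesgue" using assms(1) by simp
  have "integrable lborel (\<lambda>x. (norm (F x))\<^sup>2)"
    using assms(2,4)
    by (intro compact_support_integrable[OF assms(3)] continuous_intros) (auto intro: continuous_on_subset)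
  then have "integrable lebesgue (\<lambda>x. (norm (F x))\<^sup>2)"
    by (subst integrable_completion) (auto dest: borel_measurable_integrable)
  then have "set_integrable lebesgue \<Omega> (\<lambda>x. (norm (F x))\<^sup>2)"
    unfolding set_integrable_def by (rule integrable_mult_indicator[OF s])
  moreover have "set_borel_measurable lebesgue \<Omega> F"
    unfolding set_borel_measurable_def
    using continuous_borel_measurable_lebesgue[OF assms(2)] s by measurable
  ultimately show ?thesis by (simp add: square_integrable_def)
qed

lemma square_integrable_test_function:
  assumes "open \<Omega>" "test_function \<Omega> \<psi>"
  shows "square_integrable \<Omega> \<psi>" "square_integrable \<Omega> (\<lambda>x. \<chi> i. pderiv_at \<psi> i x)"
proof -
  obtain K where K: "compact K" "K \<subseteq> \<Omega>" "\<And>x. x \<notin> K \<Longrightarrow> \<psi> x = 0"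
    "\<And>i x. x \<notin> K \<Longrightarrow> pderiv_at \<psi> i x = 0"
    by (rule test_functionE[OF assms(2)]) blast
  show "square_integrable \<Omega> \<psi>"
    by (rule square_integrable_compact_support[OF assms(1) test_function_continuous[OF assms(2)] K(1,3)])
  show "square_integrable \<Omega> (\<lambda>x. \<chi> i. pderiv_at \<psi> i x)"
    by (rule square_integrable_compact_support[OF assms(1) _ K(1)])
      (simp_all add: K(4) vec_eq_iff continuous_on_vec_lambda
        test_function_continuous[OF test_function_pderiv[OF assms(2)]])
qed

lemma L2_null_sequence_add:
  assumes "\<And>n. square_integrable \<Omega> (F n)" "\<And>n. square_integrable \<Omega> (G n)"
    and "(\<lambda>n. LINT x:\<Omega>|lebesgue. (norm (F n x))\<^sup>2) \<longlonglongrightarrow> 0"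
    and "(\<lambda>n. LINT x:\<Omega>|lebesgue. (norm (G n x))\<^sup>2) \<longlonglongrightarrow> 0"
  shows "(\<lambda>n. LINT x:\<Omega>|lebesgue. (norm (F n x + G n x))\<^sup>2) \<longlonglongrightarrow> 0"
proof (rule tendsto_sandwich[OF _ _ tendsto_const])
  have i: "set_integrable lebesgue \<Omega> (\<lambda>x. (norm (F n x))\<^sup>2)" "set_integrable lebesgue \<Omega> (\<lambda>x. (norm (G n x))\<^sup>2)"
    "set_integrable lebesgue \<Omega> (\<lambda>x. (norm (F n x + G n x))\<^sup>2)" for n
    using assms(1,2) square_integrable_add[OF assms(1,2)] unfolding square_integrable_def by blast+
  show "\<forall>\<^sub>F n in sequentially. 0 \<le> (LINT x:\<Omega>|lebesgue. (norm (F n x + G n x))\<^sup>2)"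
    by (intro always_eventually allI) (simp add: set_lebesgue_integral_def)
  show "\<forall>\<^sub>F n in sequentially. (LINT x:\<Omega>|lebesgue. (norm (F n x + G n x))\<^sup>2)
      \<le> 2 * (LINT x:\<Omega>|lebesgue. (norm (F n x))\<^sup>2) + 2 * (LINT x:\<Omega>|lebesgue. (norm (G n x))\<^sup>2)"
  proof (intro always_eventually allI)
    fix n
    have "(LINT x:\<Omega>|lebesgue. (norm (F n x + G n x))\<^sup>2)
        \<le> (LINT x:\<Omega>|lebesgue. 2 * (norm (F n x))\<^sup>2 + 2 * (norm (G n x))\<^sup>2)"
      using i by (intro set_integral_mono norm_add_squared_le) simp_all
    also have "\<dots> = 2 * (LINT x:\<Omega>|lebesgue. (norm (F n x))\<^sup>2) + 2 * (LINT x:\<Omega>|lebesgue. (norm (G n x))\<^sup>2)"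
      using i by (simp add: set_integral_add(2))
    finally show "(LINT x:\<Omega>|lebesgue. (norm (F n x + G n x))\<^sup>2)
      \<le> 2 * (LINT x:\<Omega>|lebesgue. (norm (F n x))\<^sup>2) + 2 * (LINT x:\<Omega>|lebesgue. (norm (G n x))\<^sup>2)" .
  qed
  show "(\<lambda>n. 2 * (LINT x:\<Omega>|lebesgue. (norm (F n x))\<^sup>2) + 2 * (LINT x:\<Omega>|lebesgue. (norm (G n x))\<^sup>2)) \<longlonglongrightarrow> 0"
    using tendsto_add[OF tendsto_mult_left[OF assms(3), of 2] tendsto_mult_left[OF assms(4), of 2]] by simp
qed

lemma L2_null_sequence_bounded_linear:
  fixes F :: "nat \<Rightarrow> real ^ 2 \<Rightarrow> 'b::euclidean_space" and L :: "'b \<Rightarrow> 'c::euclidean_space"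
  assumes "bounded_linear L" "\<And>n. square_integrable \<Omega> (F n)"
    and "(\<lambda>n. LINT x:\<Omega>|lebesgue. (norm (F n x))\<^sup>2) \<longlonglongrightarrow> 0"
  shows "(\<lambda>n. LINT x:\<Omega>|lebesgue. (norm (L (F n x)))\<^sup>2) \<longlonglongrightarrow> 0"
proof (rule tendsto_sandwich[OF _ _ tendsto_const])
  have i: "set_integrable lebesgue \<Omega> (\<lambda>x. (norm (F n x))\<^sup>2)" "set_integrable lebesgue \<Omega> (\<lambda>x. (norm (L (F n x)))\<^sup>2)" for n
    using assms(2) square_integrable_bounded_linear[OF assms(1,2)] unfolding square_integrable_def by blast+
  show "\<forall>\<^sub>F n in sequentially. 0 \<le> (LINT x:\<Omega>|lebesgue. (norm (L (F n x)))\<^sup>2)"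
    by (intro always_eventually allI) (simp add: set_lebesgue_integral_def)
  have le: "(norm (L (F n x)))\<^sup>2 \<le> (onorm L)\<^sup>2 * (norm (F n x))\<^sup>2" for n x
    unfolding power_mult_distrib[symmetric] by (intro power_mono onorm assms(1)) simp
  have "(LINT x:\<Omega>|lebesgue. (norm (L (F n x)))\<^sup>2) \<le> (LINT x:\<Omega>|lebesgue. (onorm L)\<^sup>2 * (norm (F n x))\<^sup>2)" for n
    using i le by (intro set_integral_mono) simp_all
  then show "\<forall>\<^sub>F n in sequentially. (LINT x:\<Omega>|lebesgue. (norm (L (F n x)))\<^sup>2)
      \<le> (onorm L)\<^sup>2 * (LINT x:\<Omega>|lebesgue. (norm (F n x))\<^sup>2)"
    by simp
  show "(\<lambda>n. (onorm L)\<^sup>2 * (LINT x:\<Omega>|lebesgue. (norm (F n x))\<^sup>2)) \<longlonglongrightarrow> 0"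
    using tendsto_mult_left[OF assms(3)] by simp
qed

lemma has_weak_gradient_add:
  assumes "has_weak_gradient \<Omega> f g" "has_weak_gradient \<Omega> f' g'"
  shows "has_weak_gradient \<Omega> (\<lambda>x. f x + f' x) (\<lambda>x. g x + g' x)"
proof -
  note f = has_weak_gradientD[OF assms(1)] and f' = has_weak_gradientD[OF assms(2)]
  have "(LINT x:\<Omega>|lebesgue. pderiv_at \<psi> i x *\<^sub>R (f x + f' x)) = - (LINT x:\<Omega>|lebesgue. \<psi> x *\<^sub>R ((g x + g' x) $ i))"
    if t: "test_function \<Omega> \<psi>" for \<psi> :: "real ^ 2 \<Rightarrow> real" and i
  proof -
    note t' = test_function_pderiv[OF t, of i]
    have g: "locally_integrable \<Omega> (\<lambda>x. g x $ i)" and g': "locally_integrable \<Omega> (\<lambda>x. g' x $ i)"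
      using locally_integrable_bounded_linear[OF bounded_linear_vec_nth f(2)]
        locally_integrable_bounded_linear[OF bounded_linear_vec_nth f'(2)] .
    have "(LINT x:\<Omega>|lebesgue. pderiv_at \<psi> i x *\<^sub>R f x + pderiv_at \<psi> i x *\<^sub>R f' x)
        = (LINT x:\<Omega>|lebesgue. pderiv_at \<psi> i x *\<^sub>R f x) + (LINT x:\<Omega>|lebesgue. pderiv_at \<psi> i x *\<^sub>R f' x)"
      by (intro set_integral_add(2) test_function_times_locally_integrable[OF t'] f(1) f'(1))
    moreover have "(LINT x:\<Omega>|lebesgue. \<psi> x *\<^sub>R (g x $ i) + \<psi> x *\<^sub>R (g' x $ i))
        = (LINT x:\<Omega>|lebesgue. \<psi> x *\<^sub>R (g x $ i)) + (LINT x:\<Omega>|lebesgue. \<psi> x *\<^sub>R (g' x $ i))"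
      by (intro set_integral_add(2) test_function_times_locally_integrable[OF t] g g')
    ultimately show ?thesis
      using f(3)[OF t, of i] f'(3)[OF t, of i] by (simp add: scaleR_add_right)
  qed
  then show ?thesis
    using locally_integrable_add[OF f(1) f'(1)] locally_integrable_add[OF f(2) f'(2)]
    unfolding has_weak_gradient_def by blast
qed

lemma bounded_linear_map_vec:
  fixes L :: "'b::euclidean_space \<Rightarrow> 'c::euclidean_space"
  assumes "bounded_linear L"
  shows "bounded_linear (\<lambda>v :: 'b ^ 'n. \<chi> i. L (v $ i))"
proof -
  interpret L: bounded_linear L by fact
  show ?thesis
    by (intro linear_conv_bounded_linear[THEN iffD1] linearI)
      (simp_all add: vec_eq_iff L.add L.scaleR)
qed

lemma has_weak_gradient_bounded_linear:
  fixes f :: "real ^ 2 \<Rightarrow> 'b::euclidean_space" and L :: "'b \<Rightarrow> 'c::euclidean_space"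
  assumes "bounded_linear L" "has_weak_gradient \<Omega> f g"
  shows "has_weak_gradient \<Omega> (\<lambda>x. L (f x)) (\<lambda>x. \<chi> i. L (g x $ i))"
proof -
  interpret L: bounded_linear L by fact
  note f = has_weak_gradientD[OF assms(2)]
  have comm: "(LINT x:\<Omega>|lebesgue. \<eta> x *\<^sub>R L (h x)) = L (LINT x:\<Omega>|lebesgue. \<eta> x *\<^sub>R h x)"
    if t: "test_function \<Omega> \<eta>" and h: "locally_integrable \<Omega> h" for \<eta> :: "real ^ 2 \<Rightarrow> real" and h
    using integral_bounded_linear[OF assms(1)
        test_function_times_locally_integrable[OF t h, unfolded set_integrable_def]]
    by (simp add: set_lebesgue_integral_def L.scaleR)
  have "(LINT x:\<Omega>|lebesgue. pderiv_at \<psi> i x *\<^sub>R L (f x)) = - (LINT x:\<Omega>|lebesgue. \<psi> x *\<^sub>R ((\<chi> i. L (g x $ i)) $ i))"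
    if t: "test_function \<Omega> \<psi>" for \<psi> :: "real ^ 2 \<Rightarrow> real" and i
  proof -
    have g: "locally_integrable \<Omega> (\<lambda>x. g x $ i)"
      by (rule locally_integrable_bounded_linear[OF bounded_linear_vec_nth f(2)])
    show ?thesis
      unfolding comm[OF test_function_pderiv[OF t] f(1)] vec_lambda_beta comm[OF t g] f(3)[OF t]
      by (rule linear_neg[OF bounded_linear.linear[OF assms(1)]])
  qed
  then show ?thesis
    using locally_integrable_bounded_linear[OF assms(1) f(1)]
      locally_integrable_bounded_linear[OF bounded_linear_map_vec[OF assms(1)] f(2)]
    unfolding has_weak_gradient_def by blast
qed

lemma has_weak_gradient_cong:
  assumes "\<And>x. x \<in> \<Omega> \<Longrightarrow> f x = f' x"
  shows "has_weak_gradient \<Omega> f = has_weak_gradient \<Omega> f'"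
proof -
  have "locally_integrable \<Omega> f \<longleftrightarrow> locally_integrable \<Omega> f'"
    unfolding locally_integrable_def using assms
    by (intro all_cong1 imp_cong refl set_integrable_cong) auto
  moreover have "(LINT x:\<Omega>|lebesgue. pderiv_at \<psi> i x *\<^sub>R f x) = (LINT x:\<Omega>|lebesgue. pderiv_at \<psi> i x *\<^sub>R f' x)"
    for \<psi> :: "real ^ 2 \<Rightarrow> real" and i
    unfolding set_lebesgue_integral_def using assms
    by (intro Bochner_Integration.integral_cong) (auto simp: indicator_def)
  ultimately show ?thesis unfolding has_weak_gradient_def by (intro ext) (simp only:)
qed

lemma grad_cong: "(\<And>x. x \<in> \<Omega> \<Longrightarrow> f x = f' x) \<Longrightarrow> grad \<Omega> f = grad \<Omega> f'"
  unfolding grad_def by (subst has_weak_gradient_cong[of \<Omega> f f']) auto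

text \<open>Constants have weak gradient 0, so both functions have the same weak gradients and \<open>grad\<close> chooses the
same representative for both: the equality holds everywhere.\<close>

lemma grad_add_const: "grad \<Omega> (\<lambda>x. f x + c) = grad \<Omega> f"
proof -
  have "has_weak_gradient \<Omega> (\<lambda>x. f x + c) g \<longleftrightarrow> has_weak_gradient \<Omega> f g" for g
    using has_weak_gradient_add[OF _ has_weak_gradient_const, of \<Omega> f g c]
      has_weak_gradient_add[OF _ has_weak_gradient_const, of \<Omega> "\<lambda>x. f x + c" g "- c"]
    by auto
  then show ?thesis by (simp add: grad_def)
qed

text \<open>The definition measures convergence against the representative chosen by \<open>grad\<close>. Any square integrable
weak gradient serves as well, which makes closure properties provable with an explicit gradient.\<close>

lemma H1_0_iff:
  fixes f :: "real ^ 2 \<Rightarrow> 'b::euclidean_space"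
  assumes "open \<Omega>"
  shows "f \<in> H1_0 \<Omega> \<longleftrightarrow> square_integrable \<Omega> f \<and>
    (\<exists>g. has_weak_gradient \<Omega> f g \<and> square_integrable \<Omega> g \<and>
      (\<exists>\<psi> :: nat \<Rightarrow> real ^ 2 \<Rightarrow> 'b. (\<forall>n. test_function \<Omega> (\<psi> n)) \<and>
        (\<lambda>n. LINT x:\<Omega>|lebesgue. (norm (\<psi> n x - f x))\<^sup>2) \<longlonglongrightarrow> 0 \<and>
        (\<lambda>n. LINT x:\<Omega>|lebesgue. (norm ((\<chi> i. pderiv_at (\<psi> n) i x) - g x))\<^sup>2) \<longlonglongrightarrow> 0))"
proof -
  let ?A = "\<lambda>g (\<psi> :: nat \<Rightarrow> real ^ 2 \<Rightarrow> 'b). (\<forall>n. test_function \<Omega> (\<psi> n)) \<and>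
        (\<lambda>n. LINT x:\<Omega>|lebesgue. (norm (\<psi> n x - f x))\<^sup>2) \<longlonglongrightarrow> 0 \<and>
        (\<lambda>n. LINT x:\<Omega>|lebesgue. (norm ((\<chi> i. pderiv_at (\<psi> n) i x) - g x))\<^sup>2) \<longlonglongrightarrow> 0"
  have "?A (grad \<Omega> f) \<psi> \<longleftrightarrow> ?A g \<psi>" if "has_weak_gradient \<Omega> f g" for g \<psi>
  proof -
    have "(LINT x:\<Omega>|lebesgue. (norm ((\<chi> i. pderiv_at (\<psi> n) i x) - grad \<Omega> f x))\<^sup>2)
        = (LINT x:\<Omega>|lebesgue. (norm ((\<chi> i. pderiv_at (\<psi> n) i x) - g x))\<^sup>2)" for n
      by (rule set_integral_cong_AE_lebesgue)
        (use grad_AE_eq[OF assms that] in \<open>auto elim!: eventually_mono\<close>)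
    then show ?thesis by (simp only:)
  qed
  then show ?thesis unfolding H1_0_def H1_def mem_Collect_eq by blast
qed

lemma H1_0_add:
  fixes f g :: "real ^ 2 \<Rightarrow> 'b::euclidean_space"
  assumes "open \<Omega>" "f \<in> H1_0 \<Omega>" "g \<in> H1_0 \<Omega>"
  shows "(\<lambda>x. f x + g x) \<in> H1_0 \<Omega>"
proof -
  from assms(2)[unfolded H1_0_iff[OF assms(1)]] obtain F \<psi> where f: "square_integrable \<Omega> f"
    "has_weak_gradient \<Omega> f F" "square_integrable \<Omega> F" "\<And>n::nat. test_function \<Omega> (\<psi> n)"
    "(\<lambda>n. LINT x:\<Omega>|lebesgue. (norm (\<psi> n x - f x))\<^sup>2) \<longlonglongrightarrow> 0"
    "(\<lambda>n. LINT x:\<Omega>|lebesgue. (norm ((\<chi> i. pderiv_at (\<psi> n) i x) - F x))\<^sup>2) \<longlonglongrightarrow> 0"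
    by blast
  from assms(3)[unfolded H1_0_iff[OF assms(1)]] obtain G \<eta> where g: "square_integrable \<Omega> g"
    "has_weak_gradient \<Omega> g G" "square_integrable \<Omega> G" "\<And>n::nat. test_function \<Omega> (\<eta> n)"
    "(\<lambda>n. LINT x:\<Omega>|lebesgue. (norm (\<eta> n x - g x))\<^sup>2) \<longlonglongrightarrow> 0"
    "(\<lambda>n. LINT x:\<Omega>|lebesgue. (norm ((\<chi> i. pderiv_at (\<eta> n) i x) - G x))\<^sup>2) \<longlonglongrightarrow> 0"
    by blast
  have "(\<lambda>n. LINT x:\<Omega>|lebesgue. (norm ((\<psi> n x - f x) + (\<eta> n x - g x)))\<^sup>2) \<longlonglongrightarrow> 0"
    by (intro L2_null_sequence_add square_integrable_diff square_integrable_test_function[OF assms(1)] f g)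
  moreover have "(\<lambda>n. LINT x:\<Omega>|lebesgue. (norm (((\<chi> i. pderiv_at (\<psi> n) i x) - F x)
      + ((\<chi> i. pderiv_at (\<eta> n) i x) - G x)))\<^sup>2) \<longlonglongrightarrow> 0"
    by (intro L2_null_sequence_add square_integrable_diff square_integrable_test_function[OF assms(1)] f g)
  moreover have "(\<chi> i. pderiv_at (\<lambda>x. \<psi> n x + \<eta> n x) i x) - (F x + G x)
      = ((\<chi> i. pderiv_at (\<psi> n) i x) - F x) + ((\<chi> i. pderiv_at (\<eta> n) i x) - G x)" for n x
    by (simp add: vec_eq_iff pderiv_at_add[OF test_function_differentiable[OF f(4)] test_function_differentiable[OF g(4)]])
  moreover have "\<psi> n x + \<eta> n x - (f x + g x) = (\<psi> n x - f x) + (\<eta> n x - g x)" for n x by simp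
  ultimately show ?thesis
    unfolding H1_0_iff[OF assms(1)]
    by (intro conjI square_integrable_add f g exI[of _ "\<lambda>x. F x + G x"] has_weak_gradient_add
        exI[of _ "\<lambda>n x. \<psi> n x + \<eta> n x"] allI test_function_add) (simp_all only:)
qed

lemma H1_0_bounded_linear:
  fixes f :: "real ^ 2 \<Rightarrow> 'b::euclidean_space" and L :: "'b \<Rightarrow> 'c::euclidean_space"
  assumes "open \<Omega>" "bounded_linear L" "f \<in> H1_0 \<Omega>"
  shows "(\<lambda>x. L (f x)) \<in> H1_0 \<Omega>"
proof -
  interpret L: bounded_linear L by fact
  from assms(3)[unfolded H1_0_iff[OF assms(1)]] obtain F \<psi> where f: "square_integrable \<Omega> f"
    "has_weak_gradient \<Omega> f F" "square_integrable \<Omega> F" "\<And>n::nat. test_function \<Omega> (\<psi> n)"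
    "(\<lambda>n. LINT x:\<Omega>|lebesgue. (norm (\<psi> n x - f x))\<^sup>2) \<longlonglongrightarrow> 0"
    "(\<lambda>n. LINT x:\<Omega>|lebesgue. (norm ((\<chi> i. pderiv_at (\<psi> n) i x) - F x))\<^sup>2) \<longlonglongrightarrow> 0"
    by blast
  have "(\<lambda>n. LINT x:\<Omega>|lebesgue. (norm (L (\<psi> n x - f x)))\<^sup>2) \<longlonglongrightarrow> 0"
    by (rule L2_null_sequence_bounded_linear[OF assms(2)])
      (intro square_integrable_diff square_integrable_test_function[OF assms(1)] f)+
  moreover have "(\<lambda>n. LINT x:\<Omega>|lebesgue. (norm (\<chi> j. L (((\<chi> i. pderiv_at (\<psi> n) i x) - F x) $ j)))\<^sup>2) \<longlonglongrightarrow> 0"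
    by (rule L2_null_sequence_bounded_linear[OF bounded_linear_map_vec[OF assms(2)]])
      (intro square_integrable_diff square_integrable_test_function[OF assms(1)] f)+
  moreover have "(\<chi> i. pderiv_at (\<lambda>x. L (\<psi> n x)) i x) - (\<chi> i. L (F x $ i))
      = (\<chi> j. L (((\<chi> i. pderiv_at (\<psi> n) i x) - F x) $ j))" for n x
    by (simp add: pderiv_at_bounded_linear[OF assms(2) test_function_differentiable[OF f(4)]] vec_eq_iff L.diff)
  ultimately show ?thesis
    unfolding H1_0_iff[OF assms(1)]
    using square_integrable_bounded_linear[OF assms(2) f(1)] has_weak_gradient_bounded_linear[OF assms(2) f(2)]
      square_integrable_bounded_linear[OF bounded_linear_map_vec[OF assms(2)] f(3)]
      test_function_bounded_linear[OF assms(2) f(4)]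
    by (intro conjI exI[of _ "\<lambda>x. \<chi> i. L (F x $ i)"] exI[of _ "\<lambda>n x. L (\<psi> n x)"] allI)
      (simp_all only: L.diff[symmetric])
qed

lemma H1_0_zero:
  assumes "open \<Omega>"
  shows "(\<lambda>x. 0 :: 'b::euclidean_space) \<in> H1_0 \<Omega>"
proof -
  note sq = square_integrable_test_function(1)[OF assms test_function_0]
  have "pderiv_at (\<lambda>x. 0 :: 'b) i x = 0" for i x
  proof -
    have "((\<lambda>x. 0 :: 'b) has_derivative (\<lambda>_. 0)) (at x)" by simp
    from pderiv_at_eq[OF this] show ?thesis .
  qed
  then have "((\<chi> i. pderiv_at (\<lambda>x. 0) i x) :: 'b ^ 2) = 0" for x
    by (simp add: vec_eq_iff)
  then show ?thesis
    unfolding H1_0_iff[OF assms]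
    by (intro conjI exI[of _ "\<lambda>x. 0"] exI[of _ "\<lambda>n x. 0"] has_weak_gradient_const)
      (simp_all add: sq test_function_0 set_lebesgue_integral_def)
qed

section \<open>Finite element functions and integrals of finite sums\<close>

lemma finite_internal_nodes:
  assumes "triangulation_of \<Omega> T"
  shows "finite (internal_nodes \<Omega> T)"
proof -
  have T: "finite T" "\<And>K. K \<in> T \<Longrightarrow> 2 simplex K"
    using assms by (simp_all add: triangulation_of_def triangulation_def)
  have "finite {z. z extreme_point_of K}" if K: "K \<in> T" for K
  proof -
    obtain C where "finite C" "K = convex hull C" using T(2)[OF K] by (auto simp: simplex)
    then show ?thesis using extreme_points_of_convex_hull finite_subset by blast
  qed
  then have "finite (\<Union>K\<in>T. {z. z extreme_point_of K})" using T(1) by blast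
  then show ?thesis by (rule rev_finite_subset) (auto simp: internal_nodes_def)
qed

lemma V_space_bounded_linear:
  fixes f :: "real ^ 2 \<Rightarrow> 'b::euclidean_space" and L :: "'b \<Rightarrow> 'c::euclidean_space"
  assumes "open \<Omega>" "bounded_linear L" "f \<in> V_space \<Omega> T"
  shows "(\<lambda>x. L (f x)) \<in> V_space \<Omega> T"
proof -
  interpret L: bounded_linear L by fact
  have f: "continuous_on (closure \<Omega>) f" "f \<in> H1_0 \<Omega>"
    "\<And>K. K \<in> T \<Longrightarrow> \<exists>c. \<exists>d :: 'b ^ 2. \<forall>x\<in>K. f x = c + (\<Sum>i\<in>UNIV. (x $ i) *\<^sub>R (d $ i))"
    using assms(3) by (auto simp: V_space_def W_space_def)
  have "\<exists>c. \<exists>d :: 'c ^ 2. \<forall>x\<in>K. L (f x) = c + (\<Sum>i\<in>UNIV. (x $ i) *\<^sub>R (d $ i))" if K: "K \<in> T" for K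
  proof -
    obtain c and d :: "'b ^ 2" where cd: "\<forall>x\<in>K. f x = c + (\<Sum>i\<in>UNIV. (x $ i) *\<^sub>R (d $ i))"
      using f(3)[OF K] by blast
    show ?thesis
      by (rule exI[of _ "L c"], rule exI[of _ "\<chi> i. L (d $ i)"])
        (simp add: cd L.add L.sum L.scaleR)
  qed
  then show ?thesis
    using L.continuous_on[OF f(1)] H1_0_bounded_linear[OF assms(1,2) f(2)]
    by (simp add: V_space_def W_space_def)
qed

lemma W_space_add:
  fixes f g :: "real ^ 2 \<Rightarrow> 'b::euclidean_space"
  assumes "f \<in> W_space \<Omega> T" "g \<in> W_space \<Omega> T"
  shows "(\<lambda>x. f x + g x) \<in> W_space \<Omega> T"
proof -
  have "\<exists>c. \<exists>d :: 'b ^ 2. \<forall>x\<in>K. f x + g x = c + (\<Sum>i\<in>UNIV. (x $ i) *\<^sub>R (d $ i))" if K: "K \<in> T" for K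
  proof -
    obtain c d c' and d' :: "'b ^ 2" where "\<forall>x\<in>K. f x = c + (\<Sum>i\<in>UNIV. (x $ i) *\<^sub>R (d $ i))"
      "\<forall>x\<in>K. g x = c' + (\<Sum>i\<in>UNIV. (x $ i) *\<^sub>R (d' $ i))"
      using assms K unfolding W_space_def by blast
    then show ?thesis
      by (intro exI[of _ "c + c'"] exI[of _ "d + d'"]) (simp add: sum.distrib scaleR_add_right)
  qed
  then show ?thesis using assms by (simp add: W_space_def continuous_on_add)
qed

lemma W_space_const:
  fixes c :: "'b::euclidean_space"
  shows "(\<lambda>x. c) \<in> W_space \<Omega> T"
  unfolding W_space_def by (auto intro!: exI[of _ c] exI[of _ "0 :: 'b ^ 2"])

lemma V_space_sum:
  fixes \<phi> :: "'a \<Rightarrow> real ^ 2 \<Rightarrow> real" and c :: "'a \<Rightarrow> 'b::euclidean_space"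
  assumes "open \<Omega>" "finite N" "\<And>z. z \<in> N \<Longrightarrow> \<phi> z \<in> V_space \<Omega> T"
  shows "(\<lambda>x. \<Sum>z\<in>N. \<phi> z x *\<^sub>R c z) \<in> V_space \<Omega> T"
  using assms(2,3)
proof (induction N rule: finite_induct)
  case empty
  show ?case using H1_0_zero[OF assms(1)] W_space_const[of "0 :: 'b" \<Omega> T] by (simp add: V_space_def)
next
  case (insert z N)
  have "(\<lambda>x. \<phi> z x *\<^sub>R c z) \<in> V_space \<Omega> T"
    by (rule V_space_bounded_linear[OF assms(1) bounded_linear_scaleR_left]) (simp add: insert.prems)
  moreover have "(\<lambda>x. \<Sum>z\<in>N. \<phi> z x *\<^sub>R c z) \<in> V_space \<Omega> T"
    using insert by simp
  ultimately have "(\<lambda>x. \<phi> z x *\<^sub>R c z + (\<Sum>z\<in>N. \<phi> z x *\<^sub>R c z)) \<in> V_space \<Omega> T"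
    unfolding V_space_def by (auto intro: W_space_add H1_0_add[OF assms(1)])
  then show ?case using insert.hyps by simp
qed

lemma has_weak_gradient_sum:
  fixes \<phi> :: "'a \<Rightarrow> real ^ 2 \<Rightarrow> real" and c :: "'a \<Rightarrow> 'b::euclidean_space"
  assumes "finite N" "\<And>z. z \<in> N \<Longrightarrow> has_weak_gradient \<Omega> (\<phi> z) (g z)"
  shows "has_weak_gradient \<Omega> (\<lambda>x. \<Sum>z\<in>N. \<phi> z x *\<^sub>R c z) (\<lambda>x. \<chi> i. \<Sum>z\<in>N. (g z x $ i) *\<^sub>R c z)"
  using assms
proof (induction N rule: finite_induct)
  case empty
  have "(\<chi> i. (0 :: 'b)) = (0 :: 'b ^ 2)" by (simp add: vec_eq_iff)
  then show ?case using has_weak_gradient_const[of \<Omega> "0 :: 'b"] by simp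
next
  case (insert z N)
  have "has_weak_gradient \<Omega> (\<lambda>x. \<phi> z x *\<^sub>R c z) (\<lambda>x. \<chi> i. (g z x $ i) *\<^sub>R c z)"
    by (rule has_weak_gradient_bounded_linear[OF bounded_linear_scaleR_left]) (simp add: insert.prems)
  moreover have "has_weak_gradient \<Omega> (\<lambda>x. \<Sum>z\<in>N. \<phi> z x *\<^sub>R c z) (\<lambda>x. \<chi> i. \<Sum>z\<in>N. (g z x $ i) *\<^sub>R c z)"
    using insert by simp
  ultimately have "has_weak_gradient \<Omega> (\<lambda>x. \<phi> z x *\<^sub>R c z + (\<Sum>z\<in>N. \<phi> z x *\<^sub>R c z))
      (\<lambda>x. (\<chi> i. (g z x $ i) *\<^sub>R c z) + (\<chi> i. \<Sum>z\<in>N. (g z x $ i) *\<^sub>R c z))"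
    by (rule has_weak_gradient_add)
  moreover have "(\<chi> i. (g z x $ i) *\<^sub>R c z) + (\<chi> i. \<Sum>z\<in>N. (g z x $ i) *\<^sub>R c z)
      = (\<chi> i. \<Sum>z\<in>insert z N. (g z x $ i) *\<^sub>R c z)" for x
    using insert.hyps by (simp add: vec_eq_iff)
  ultimately show ?case using insert.hyps by simp
qed

lemma set_integral_sum_scaleR:
  fixes f :: "'i \<Rightarrow> 'a \<Rightarrow> real" and k :: "'i \<Rightarrow> 'b::{banach, second_countable_topology}"
  assumes "finite N" "\<And>z. z \<in> N \<Longrightarrow> set_integrable M A (f z)"
  shows "set_integrable M A (\<lambda>x. \<Sum>z\<in>N. f z x *\<^sub>R k z)"
    and "(LINT x:A|M. \<Sum>z\<in>N. f z x *\<^sub>R k z) = (\<Sum>z\<in>N. (LINT x:A|M. f z x) *\<^sub>R k z)"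
proof -
  have eq: "indicator A x *\<^sub>R (\<Sum>z\<in>N. f z x *\<^sub>R k z) = (\<Sum>z\<in>N. (indicator A x *\<^sub>R f z x) *\<^sub>R k z)" for x
    by (simp add: scaleR_sum_right)
  have i: "integrable M (\<lambda>x. (indicator A x *\<^sub>R f z x) *\<^sub>R k z)" if "z \<in> N" for z
    using assms(2)[OF that] unfolding set_integrable_def by (intro integrable_scaleR_left) 
  show "set_integrable M A (\<lambda>x. \<Sum>z\<in>N. f z x *\<^sub>R k z)"
    unfolding set_integrable_def eq using i by (rule Bochner_Integration.integrable_sum)
  show "(LINT x:A|M. \<Sum>z\<in>N. f z x *\<^sub>R k z) = (\<Sum>z\<in>N. (LINT x:A|M. f z x) *\<^sub>R k z)"
    unfolding set_lebesgue_integral_def eq using i assms(2)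
    by (subst Bochner_Integration.integral_sum)
      (auto intro!: sum.cong integral_scaleR_left simp: set_integrable_def)
qed

lemma set_integral_sum_sum_scaleR:
  fixes f :: "'i \<Rightarrow> 'i \<Rightarrow> 'a \<Rightarrow> real" and k :: "'i \<Rightarrow> 'i \<Rightarrow> 'b::{banach, second_countable_topology}"
  assumes "finite N" "\<And>z y. z \<in> N \<Longrightarrow> y \<in> N \<Longrightarrow> set_integrable M A (f z y)"
  shows "set_integrable M A (\<lambda>x. \<Sum>z\<in>N. \<Sum>y\<in>N. f z y x *\<^sub>R k z y)"
    and "(LINT x:A|M. \<Sum>z\<in>N. \<Sum>y\<in>N. f z y x *\<^sub>R k z y) = (\<Sum>z\<in>N. \<Sum>y\<in>N. (LINT x:A|M. f z y x) *\<^sub>R k z y)"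
  using set_integral_sum_scaleR[of "N \<times> N" M A "\<lambda>p. f (fst p) (snd p)" "\<lambda>p. k (fst p) (snd p)"] assms
  by (auto simp: sum.cartesian_product case_prod_beta)

lemma continuous_on_closure_set_integrable:
  fixes f :: "real ^ 2 \<Rightarrow> 'b::euclidean_space"
  assumes "open \<Omega>" "bounded \<Omega>" "continuous_on (closure \<Omega>) f"
  shows "set_integrable lebesgue \<Omega> f"
proof (rule set_integrable_subset[of _ "closure \<Omega>"])
  have "integrable lborel (\<lambda>x. indicator (closure \<Omega>) x *\<^sub>R f x)"
    using assms(2,3) by (intro borel_integrable_compact) auto
  then show "set_integrable lebesgue (closure \<Omega>) f"
    unfolding set_integrable_def
    by (subst integrable_completion) (auto dest: borel_measurable_integrable)
qed (use assms(1) closure_subset in auto)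

lemma continuous_on_parametric_integral:
  fixes F :: "'p::metric_space \<Rightarrow> real ^ 2 \<Rightarrow> real"
  assumes "open \<Omega>" "bounded \<Omega>"
    and "\<And>p. continuous_on (closure \<Omega>) (F p)"
    and "\<And>x. x \<in> \<Omega> \<Longrightarrow> continuous_on UNIV (\<lambda>p. F p x)"
    and w: "continuous_on (closure \<Omega>) w" "\<And>p x. x \<in> \<Omega> \<Longrightarrow> \<bar>F p x\<bar> \<le> w x"
  shows "continuous_on UNIV (\<lambda>p. LINT x:\<Omega>|lebesgue. F p x)"
proof (subst continuous_on_sequentially, intro allI ballI impI, elim conjE)
  fix p :: "nat \<Rightarrow> 'p" and a assume pa: "p \<longlonglongrightarrow> a"
  note int = continuous_on_closure_set_integrable[OF assms(1,2), unfolded set_integrable_def]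
  show "((\<lambda>p. LINT x:\<Omega>|lebesgue. F p x) \<circ> p) \<longlonglongrightarrow> (LINT x:\<Omega>|lebesgue. F a x)"
    unfolding o_def set_lebesgue_integral_def
  proof (rule integral_dominated_convergence[where w = "\<lambda>x. indicator \<Omega> x *\<^sub>R w x"])
    show "AE x in lebesgue. (\<lambda>n. indicator \<Omega> x *\<^sub>R F (p n) x) \<longlonglongrightarrow> indicator \<Omega> x *\<^sub>R F a x"
    proof (intro always_eventually allI)
      fix x
      show "(\<lambda>n. indicator \<Omega> x *\<^sub>R F (p n) x) \<longlonglongrightarrow> indicator \<Omega> x *\<^sub>R F a x"
      proof (cases "x \<in> \<Omega>")
        case True
        from continuous_on_tendsto_compose[OF assms(4)[OF True] pa] show ?thesis
          by (intro tendsto_scaleR tendsto_const) simp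
      qed simp
    qed
    show "AE x in lebesgue. norm (indicator \<Omega> x *\<^sub>R F (p n) x) \<le> indicator \<Omega> x *\<^sub>R w x" for n
      using w(2) by (intro always_eventually allI) (auto simp: indicator_def)
  qed (use int[OF assms(3)] int[OF w(1)] in \<open>auto dest: borel_measurable_integrable\<close>)
qed

section \<open>The discrete problem\<close>

text \<open>The properties of the Lagrange basis \<open>\<phi>\<close> that the discrete problem uses, with \<open>g z\<close> a fixed square
integrable weak gradient of \<open>\<phi> z\<close>.\<close>

locale nodal_basis =
  fixes \<Omega> N :: "(real ^ 2) set" and \<phi> :: "real ^ 2 \<Rightarrow> real ^ 2 \<Rightarrow> real"
    and g :: "real ^ 2 \<Rightarrow> real ^ 2 \<Rightarrow> real ^ 2"
  assumes open_dom: "open \<Omega>" and bounded_dom: "bounded \<Omega>"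
    and finite_nodes: "finite N" and nodes_sub: "N \<subseteq> \<Omega>"
    and cont: "z \<in> N \<Longrightarrow> continuous_on (closure \<Omega>) (\<phi> z)"
    and weak_grad: "z \<in> N \<Longrightarrow> has_weak_gradient \<Omega> (\<phi> z) (g z)"
    and sq_grad: "z \<in> N \<Longrightarrow> square_integrable \<Omega> (g z)"
    and nodal: "z \<in> N \<Longrightarrow> y \<in> N \<Longrightarrow> \<phi> z y = (if y = z then 1 else 0)"
begin

definition comb :: "(real ^ 2 \<Rightarrow> 'b::euclidean_space) \<Rightarrow> real ^ 2 \<Rightarrow> 'b" where
  "comb c = (\<lambda>x. \<Sum>z\<in>N. \<phi> z x *\<^sub>R c z)"

definition stiffness :: "real ^ 2 \<Rightarrow> real ^ 2 \<Rightarrow> real" where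
  "stiffness z y = (LINT x:\<Omega>|lebesgue. g z x \<bullet> g y x)"

definition mass :: "(real ^ 2 \<Rightarrow> real) \<Rightarrow> real ^ 2 \<Rightarrow> real ^ 2 \<Rightarrow> real" where
  "mass w z y = (LINT x:\<Omega>|lebesgue. w x * \<phi> z x * \<phi> y x)"

definition load :: "(real ^ 2 \<Rightarrow> real) \<Rightarrow> real ^ 2 \<Rightarrow> real" where
  "load w y = (LINT x:\<Omega>|lebesgue. w x * \<phi> y x)"

text \<open>The integral of \<open>\<bar>\<nabla>H\<bar>\<^sup>2 \<phi> y\<close> for a field \<open>H\<close> that differs from \<open>comb c\<close> by a constant,
written as a quadratic polynomial in \<open>c\<close> so that its continuity in \<open>c\<close> is evident; \<open>joule_form\<close> is
the link.\<close>

definition joule_load :: "(real ^ 2 \<Rightarrow> complex) \<Rightarrow> real ^ 2 \<Rightarrow> real" where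
  "joule_load c y = (\<Sum>z\<in>N. \<Sum>z'\<in>N. (LINT x:\<Omega>|lebesgue. (g z x \<bullet> g z' x) * \<phi> y x) * Re (c z * cnj (c z')))"

lemma comb_node: "y \<in> N \<Longrightarrow> comb c y = c y"
proof -
  assume y: "y \<in> N"
  have "comb c y = (\<Sum>z\<in>N. if z = y then c z else 0)"
    unfolding comb_def by (rule sum.cong) (auto simp: nodal y)
  then show ?thesis using y finite_nodes by simp
qed

lemma continuous_comb: "continuous_on (closure \<Omega>) (comb c)"
  unfolding comb_def by (intro continuous_on_sum continuous_on_scaleR continuous_on_const cont)

lemma grad_comb_AE:
  "AE x in lebesgue. x \<in> \<Omega> \<longrightarrow> grad \<Omega> (comb c) x = (\<chi> i. \<Sum>z\<in>N. (g z x $ i) *\<^sub>R c z)"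
  unfolding comb_def
  by (rule grad_AE_eq[OF open_dom has_weak_gradient_sum[OF finite_nodes weak_grad]])

lemma integrable_inner_grad: "z \<in> N \<Longrightarrow> y \<in> N \<Longrightarrow> set_integrable lebesgue \<Omega> (\<lambda>x. g z x \<bullet> g y x)"
  by (intro square_integrable_inner sq_grad)

lemma integrable_continuous: "continuous_on (closure \<Omega>) f \<Longrightarrow> set_integrable lebesgue \<Omega> f"
  for f :: "real ^ 2 \<Rightarrow> 'b::euclidean_space"
  by (rule continuous_on_closure_set_integrable[OF open_dom bounded_dom])

lemma inner_grad_comb_complex:
  fixes c d :: "real ^ 2 \<Rightarrow> complex"
  shows "(\<Sum>i\<in>UNIV. ((\<chi> i. \<Sum>z\<in>N. (g z x $ i) *\<^sub>R c z) :: complex ^ 2) $ i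
        * cnj (((\<chi> i. \<Sum>y\<in>N. (g y x $ i) *\<^sub>R d y) :: complex ^ 2) $ i))
    = (\<Sum>z\<in>N. \<Sum>y\<in>N. (g z x \<bullet> g y x) *\<^sub>R (c z * cnj (d y)))"
proof -
  have "(\<Sum>i\<in>UNIV. ((\<chi> i. \<Sum>z\<in>N. (g z x $ i) *\<^sub>R c z) :: complex ^ 2) $ i
        * cnj (((\<chi> i. \<Sum>y\<in>N. (g y x $ i) *\<^sub>R d y) :: complex ^ 2) $ i))
      = (\<Sum>i\<in>UNIV. \<Sum>z\<in>N. \<Sum>y\<in>N. (g z x $ i * g y x $ i) *\<^sub>R (c z * cnj (d y)))"
    by (simp add: sum_product mult_ac)
  also have "\<dots> = (\<Sum>z\<in>N. \<Sum>i\<in>UNIV. \<Sum>y\<in>N. (g z x $ i * g y x $ i) *\<^sub>R (c z * cnj (d y)))"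
    by (rule sum.swap)
  also have "\<dots> = (\<Sum>z\<in>N. \<Sum>y\<in>N. \<Sum>i\<in>UNIV. (g z x $ i * g y x $ i) *\<^sub>R (c z * cnj (d y)))"
    by (intro sum.cong refl sum.swap)
  also have "\<dots> = (\<Sum>z\<in>N. \<Sum>y\<in>N. (g z x \<bullet> g y x) *\<^sub>R (c z * cnj (d y)))"
    by (simp only: inner_vec_def inner_real_def scaleR_sum_left)
  finally show ?thesis .
qed

lemma grad_form_complex:
  "L2_complex_vec \<Omega> (grad \<Omega> (comb c)) (grad \<Omega> (comb d))
     = (\<Sum>z\<in>N. \<Sum>y\<in>N. of_real (stiffness z y) * (c z * cnj (d y)))"
proof -
  have "L2_complex_vec \<Omega> (grad \<Omega> (comb c)) (grad \<Omega> (comb d))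
      = (LINT x:\<Omega>|lebesgue. \<Sum>z\<in>N. \<Sum>y\<in>N. (g z x \<bullet> g y x) *\<^sub>R (c z * cnj (d y)))"
    unfolding L2_complex_vec_def
  proof (rule set_integral_cong_AE_lebesgue)
    show "AE x in lebesgue. x \<in> \<Omega> \<longrightarrow>
      (\<Sum>i\<in>UNIV. grad \<Omega> (comb c) x $ i * cnj (grad \<Omega> (comb d) x $ i))
        = (\<Sum>z\<in>N. \<Sum>y\<in>N. (g z x \<bullet> g y x) *\<^sub>R (c z * cnj (d y)))"
      using grad_comb_AE[of c] grad_comb_AE[of d]
    proof eventually_elim
      case (elim x)
      show ?case
      proof
        assume "x \<in> \<Omega>"
        then have e: "grad \<Omega> (comb c) x = (\<chi> i. \<Sum>z\<in>N. (g z x $ i) *\<^sub>R c z)"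
          "grad \<Omega> (comb d) x = (\<chi> i. \<Sum>z\<in>N. (g z x $ i) *\<^sub>R d z)"
          using elim by blast+
        show "(\<Sum>i\<in>UNIV. grad \<Omega> (comb c) x $ i * cnj (grad \<Omega> (comb d) x $ i))
          = (\<Sum>z\<in>N. \<Sum>y\<in>N. (g z x \<bullet> g y x) *\<^sub>R (c z * cnj (d y)))"
          unfolding e by (rule inner_grad_comb_complex)
      qed
    qed
  qed
  also have "\<dots> = (\<Sum>z\<in>N. \<Sum>y\<in>N. stiffness z y *\<^sub>R (c z * cnj (d y)))"
    unfolding stiffness_def by (intro set_integral_sum_sum_scaleR(2) finite_nodes integrable_inner_grad)
  finally show ?thesis by (simp add: scaleR_conv_of_real)
qed

lemma grad_form_real:
  "L2_real_vec \<Omega> (grad \<Omega> (comb p)) (grad \<Omega> (comb q)) = (\<Sum>z\<in>N. \<Sum>y\<in>N. stiffness z y * (p z * q y))"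
proof -
  have "L2_real_vec \<Omega> (grad \<Omega> (comb p)) (grad \<Omega> (comb q))
      = (LINT x:\<Omega>|lebesgue. \<Sum>z\<in>N. \<Sum>y\<in>N. (g z x \<bullet> g y x) *\<^sub>R (p z * q y))"
    unfolding L2_real_vec_def
  proof (rule set_integral_cong_AE_lebesgue)
    show "AE x in lebesgue. x \<in> \<Omega> \<longrightarrow> grad \<Omega> (comb p) x \<bullet> grad \<Omega> (comb q) x
        = (\<Sum>z\<in>N. \<Sum>y\<in>N. (g z x \<bullet> g y x) *\<^sub>R (p z * q y))"
      using grad_comb_AE[of p] grad_comb_AE[of q]
    proof eventually_elim
      case (elim x)
      have v: "(\<chi> i. \<Sum>z\<in>N. (g z x $ i) *\<^sub>R r z) = (\<Sum>z\<in>N. r z *\<^sub>R g z x)" for r :: "real ^ 2 \<Rightarrow> real"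
        by (simp add: vec_eq_iff mult.commute)
      show ?case
      proof
        assume "x \<in> \<Omega>"
        then have e: "grad \<Omega> (comb p) x = (\<Sum>z\<in>N. p z *\<^sub>R g z x)"
          "grad \<Omega> (comb q) x = (\<Sum>y\<in>N. q y *\<^sub>R g y x)"
          using elim v by simp_all
        show "grad \<Omega> (comb p) x \<bullet> grad \<Omega> (comb q) x
            = (\<Sum>z\<in>N. \<Sum>y\<in>N. (g z x \<bullet> g y x) *\<^sub>R (p z * q y))"
          unfolding e inner_sum_left inner_sum_right
          by (subst sum.swap) (simp add: mult_ac)
      qed
    qed
  qed
  also have "\<dots> = (\<Sum>z\<in>N. \<Sum>y\<in>N. stiffness z y *\<^sub>R (p z * q y))"
    unfolding stiffness_def by (intro set_integral_sum_sum_scaleR(2) finite_nodes integrable_inner_grad)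
  finally show ?thesis by simp
qed

lemma mass_form:
  assumes w: "continuous_on (closure \<Omega>) w"
  shows "L2_complex \<Omega> (\<lambda>x. \<i> * of_real \<omega> * of_real (w x) * comb c x) (comb d)
     = (\<Sum>z\<in>N. \<Sum>y\<in>N. of_real (mass w z y) * (\<i> * of_real \<omega> * c z * cnj (d y)))"
proof -
  have "L2_complex \<Omega> (\<lambda>x. \<i> * of_real \<omega> * of_real (w x) * comb c x) (comb d)
      = (LINT x:\<Omega>|lebesgue. \<Sum>z\<in>N. \<Sum>y\<in>N. (w x * \<phi> z x * \<phi> y x) *\<^sub>R (\<i> * of_real \<omega> * c z * cnj (d y)))"
    unfolding L2_complex_def comb_def
    by (simp add: sum_product sum_distrib_left scaleR_conv_of_real mult_ac)
  also have "\<dots> = (\<Sum>z\<in>N. \<Sum>y\<in>N. mass w z y *\<^sub>R (\<i> * of_real \<omega> * c z * cnj (d y)))"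
    unfolding mass_def
    by (intro set_integral_sum_sum_scaleR(2) finite_nodes integrable_continuous continuous_intros w cont)
  finally show ?thesis by (simp add: scaleR_conv_of_real)
qed

lemma load_form:
  assumes w: "continuous_on (closure \<Omega>) w"
  shows "L2_complex \<Omega> (\<lambda>x. \<i> * of_real \<omega> * of_real (w x) * h) (comb d)
     = (\<Sum>y\<in>N. of_real (load w y) * (\<i> * of_real \<omega> * h * cnj (d y)))"
proof -
  have "L2_complex \<Omega> (\<lambda>x. \<i> * of_real \<omega> * of_real (w x) * h) (comb d)
      = (LINT x:\<Omega>|lebesgue. \<Sum>y\<in>N. (w x * \<phi> y x) *\<^sub>R (\<i> * of_real \<omega> * h * cnj (d y)))"
    unfolding L2_complex_def comb_def
    by (simp add: sum_distrib_left scaleR_conv_of_real mult_ac)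
  also have "\<dots> = (\<Sum>y\<in>N. load w y *\<^sub>R (\<i> * of_real \<omega> * h * cnj (d y)))"
    unfolding load_def
    by (intro set_integral_sum_scaleR(2) finite_nodes integrable_continuous continuous_intros w cont)
  finally show ?thesis by (simp add: scaleR_conv_of_real)
qed

lemma integrable_inner_grad_times:
  assumes "z \<in> N" "y \<in> N" "u \<in> N"
  shows "set_integrable lebesgue \<Omega> (\<lambda>x. (g z x \<bullet> g y x) * \<phi> u x)"
proof -
  have "bounded (\<phi> u ` closure \<Omega>)"
    using cont[OF assms(3)] bounded_dom by (intro compact_imp_bounded compact_continuous_image) auto
  then obtain B where B: "\<And>x. x \<in> \<Omega> \<Longrightarrow> \<bar>\<phi> u x\<bar> \<le> B"
    using closure_subset unfolding bounded_iff by fastforce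
  have i: "integrable lebesgue (\<lambda>x. indicator \<Omega> x *\<^sub>R (g z x \<bullet> g y x))"
    "integrable lebesgue (\<lambda>x. indicator \<Omega> x *\<^sub>R \<phi> u x)"
    using integrable_inner_grad[OF assms(1,2)] integrable_continuous[OF cont[OF assms(3)]]
    by (simp_all add: set_integrable_def)
  show ?thesis
    unfolding set_integrable_def
  proof (rule Bochner_Integration.integrable_bound)
    show "integrable lebesgue (\<lambda>x. B *\<^sub>R (indicator \<Omega> x *\<^sub>R (g z x \<bullet> g y x)))"
      by (intro integrable_scaleR_right i)
    have "(\<lambda>x. (indicator \<Omega> x *\<^sub>R (g z x \<bullet> g y x)) * (indicator \<Omega> x *\<^sub>R \<phi> u x)) \<in> borel_measurable lebesgue"
      using i[THEN borel_measurable_integrable] by (rule borel_measurable_times)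
    moreover have "(\<lambda>x. (indicator \<Omega> x *\<^sub>R (g z x \<bullet> g y x)) * (indicator \<Omega> x *\<^sub>R \<phi> u x))
        = (\<lambda>x. indicator \<Omega> x *\<^sub>R ((g z x \<bullet> g y x) * \<phi> u x))"
      by (auto simp: indicator_def)
    ultimately show "(\<lambda>x. indicator \<Omega> x *\<^sub>R ((g z x \<bullet> g y x) * \<phi> u x)) \<in> borel_measurable lebesgue"
      by (simp only:)
    show "AE x in lebesgue. norm (indicator \<Omega> x *\<^sub>R ((g z x \<bullet> g y x) * \<phi> u x))
        \<le> norm (B *\<^sub>R (indicator \<Omega> x *\<^sub>R (g z x \<bullet> g y x)))"
    proof (intro always_eventually allI)
      fix x
      show "norm (indicator \<Omega> x *\<^sub>R ((g z x \<bullet> g y x) * \<phi> u x)) \<le> norm (B *\<^sub>R (indicator \<Omega> x *\<^sub>R (g z x \<bullet> g y x)))"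
      proof (cases "x \<in> \<Omega>")
        case True
        have "\<bar>g z x \<bullet> g y x\<bar> * \<bar>\<phi> u x\<bar> \<le> \<bar>g z x \<bullet> g y x\<bar> * \<bar>B\<bar>"
          using B[OF True] by (intro mult_left_mono) auto
        then show ?thesis using True by (simp add: abs_mult mult.commute)
      qed simp
    qed
  qed
qed

lemma joule_form:
  assumes H: "grad \<Omega> H = grad \<Omega> (comb c)"
  shows "L2_real \<Omega> (\<lambda>x. (norm (grad \<Omega> H x))\<^sup>2) (comb q) = (\<Sum>y\<in>N. joule_load c y * q y)"
proof -
  define G where "G = (\<lambda>x. \<Sum>z\<in>N. \<Sum>z'\<in>N. (g z x \<bullet> g z' x) *\<^sub>R Re (c z * cnj (c z')))"
  have "L2_real \<Omega> (\<lambda>x. (norm (grad \<Omega> H x))\<^sup>2) (comb q)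
      = (LINT x:\<Omega>|lebesgue. \<Sum>y\<in>N. (G x * \<phi> y x) *\<^sub>R q y)"
    unfolding L2_real_def H
  proof (rule set_integral_cong_AE_lebesgue)
    show "AE x in lebesgue. x \<in> \<Omega> \<longrightarrow> (norm (grad \<Omega> (comb c) x))\<^sup>2 * comb q x
        = (\<Sum>y\<in>N. (G x * \<phi> y x) *\<^sub>R q y)"
      using grad_comb_AE[of c]
    proof eventually_elim
      case (elim x)
      have "of_real ((norm v)\<^sup>2) = (\<Sum>i\<in>UNIV. v $ i * cnj (v $ i))" for v :: "complex ^ 2"
        by (simp add: norm_vec_def L2_set_def sum_nonneg complex_norm_square[symmetric])
      then have n: "(norm v)\<^sup>2 = Re (\<Sum>i\<in>UNIV. v $ i * cnj (v $ i))" for v :: "complex ^ 2"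
        by (metis Re_complex_of_real)
      show ?case
      proof
        assume "x \<in> \<Omega>"
        then have e: "grad \<Omega> (comb c) x = (\<chi> i. \<Sum>z\<in>N. (g z x $ i) *\<^sub>R c z)"
          using elim by blast
        have "(norm (grad \<Omega> (comb c) x))\<^sup>2 = G x"
          unfolding n e inner_grad_comb_complex G_def by (simp only: Re_sum scaleR_complex.simps real_scaleR_def)
        then show "(norm (grad \<Omega> (comb c) x))\<^sup>2 * comb q x = (\<Sum>y\<in>N. (G x * \<phi> y x) *\<^sub>R q y)"
          by (simp add: comb_def sum_distrib_left mult.assoc)
      qed
    qed
  qed
  also have "\<dots> = (\<Sum>y\<in>N. joule_load c y * q y)"
  proof -
    have eq: "G x * \<phi> y x = (\<Sum>z\<in>N. \<Sum>z'\<in>N. ((g z x \<bullet> g z' x) * \<phi> y x) *\<^sub>R Re (c z * cnj (c z')))" for x y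
      unfolding G_def by (simp add: sum_distrib_left mult_ac)
    have "set_integrable lebesgue \<Omega> (\<lambda>x. G x * \<phi> y x)"
      and "(LINT x:\<Omega>|lebesgue. G x * \<phi> y x) = joule_load c y" if y: "y \<in> N" for y
      unfolding eq joule_load_def
      using set_integral_sum_sum_scaleR[OF finite_nodes integrable_inner_grad_times[OF _ _ y], where k = "\<lambda>z z'. Re (c z * cnj (c z'))"]
      by simp_all
    then show ?thesis
      using set_integral_sum_scaleR(2)[OF finite_nodes, of lebesgue \<Omega> "\<lambda>y x. G x * \<phi> y x" q] by simp
  qed
  finally show ?thesis .
qed

text \<open>The form is the integral of \<open>w \<bar>comb c\<bar>\<^sup>2\<close>. If it vanished, the continuous function \<open>comb c\<close> would
vanish on the open set \<open>\<Omega>\<close>, in particular at the nodes, where its values are the coefficients.\<close>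

lemma mass_definite:
  assumes w: "continuous_on (closure \<Omega>) w" "\<And>x. w x > 0" and c: "\<exists>z\<in>N. c z \<noteq> 0"
  shows "\<exists>s>0. (\<Sum>y\<in>N. cnj (c y) * (\<Sum>z\<in>N. of_real (mass w z y) * c z)) = of_real s"
proof -
  have "of_real (w x * (norm (comb c x))\<^sup>2)
      = (\<Sum>z\<in>N. \<Sum>y\<in>N. (w x * \<phi> z x * \<phi> y x) *\<^sub>R (c z * cnj (c y)))" for x
    unfolding of_real_mult complex_norm_square comb_def
    by (subst sum.swap) (simp add: sum_product sum_distrib_left scaleR_conv_of_real mult_ac)
  then have "of_real (LINT x:\<Omega>|lebesgue. w x * (norm (comb c x))\<^sup>2)
      = (LINT x:\<Omega>|lebesgue. \<Sum>z\<in>N. \<Sum>y\<in>N. (w x * \<phi> z x * \<phi> y x) *\<^sub>R (c z * cnj (c y)))"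
    by (simp add: set_integral_complex_of_real[symmetric])
  also have "\<dots> = (\<Sum>z\<in>N. \<Sum>y\<in>N. mass w z y *\<^sub>R (c z * cnj (c y)))"
    unfolding mass_def
    by (intro set_integral_sum_sum_scaleR(2) finite_nodes integrable_continuous continuous_intros w cont)
  also have "\<dots> = (\<Sum>y\<in>N. cnj (c y) * (\<Sum>z\<in>N. of_real (mass w z y) * c z))"
    by (subst sum.swap) (simp add: sum_distrib_left scaleR_conv_of_real mult_ac)
  finally have eq: "(\<Sum>y\<in>N. cnj (c y) * (\<Sum>z\<in>N. of_real (mass w z y) * c z))
      = of_real (LINT x:\<Omega>|lebesgue. w x * (norm (comb c x))\<^sup>2)" by simp
  have f: "continuous_on (closure \<Omega>) (\<lambda>x. w x * (norm (comb c x))\<^sup>2)"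
    by (intro continuous_intros w continuous_comb)
  have nn: "0 \<le> w x * (norm (comb c x))\<^sup>2" for x using w(2)[of x] by simp
  have "(LINT x:\<Omega>|lebesgue. w x * (norm (comb c x))\<^sup>2) \<noteq> 0"
  proof
    assume "(LINT x:\<Omega>|lebesgue. w x * (norm (comb c x))\<^sup>2) = 0"
    moreover have "integrable lebesgue (\<lambda>x. indicator \<Omega> x *\<^sub>R (w x * (norm (comb c x))\<^sup>2))"
      using integrable_continuous[OF f] by (simp add: set_integrable_def)
    ultimately have "AE x in lebesgue. indicator \<Omega> x *\<^sub>R (w x * (norm (comb c x))\<^sup>2) = 0"
      unfolding set_lebesgue_integral_def using nn
      by (subst (asm) integral_nonneg_eq_0_iff_AE) auto
    then have ae: "AE x\<in>\<Omega> in lebesgue. x \<in> {x \<in> closure \<Omega>. comb c x \<in> {0}}"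
    proof eventually_elim
      case (elim x)
      then show ?case using w(2)[of x] closure_subset[of \<Omega>] by (auto simp: indicator_def)
    qed
    have cl: "closed {x \<in> closure \<Omega>. comb c x \<in> {0}}"
    proof -
      have "closed (closure \<Omega> \<inter> comb c -` {0})"
        by (rule continuous_closed_preimage[OF continuous_comb closed_closure closed_singleton])
      moreover have "{x \<in> closure \<Omega>. comb c x \<in> {0}} = closure \<Omega> \<inter> comb c -` {0}" by blast
      ultimately show ?thesis by (simp only:)
    qed
    have "comb c x = 0" if "x \<in> \<Omega>" for x
      using mem_closed_if_AE_lebesgue_open[of \<Omega> "{x \<in> closure \<Omega>. comb c x \<in> {0}}" x,
          OF open_dom cl ae that] by simp
    note zero = this
    obtain z where z: "z \<in> N" "c z \<noteq> 0" using c by blast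
    then show False using zero[of z] comb_node[of z c] nodes_sub by (simp add: subset_iff)
  qed
  then have "(LINT x:\<Omega>|lebesgue. w x * (norm (comb c x))\<^sup>2) > 0"
    using nn by (simp add: set_lebesgue_integral_def less_le)
  then show ?thesis using eq by blast
qed

text \<open>The stiffness matrix is real and symmetric, so its Hermitian form is real; only the mass term
contributes to the imaginary part of the magnetic form.\<close>

lemma stiffness_form_real:
  "Im (\<Sum>y\<in>N. cnj (c y) * (\<Sum>z\<in>N. of_real (stiffness z y) * c z)) = 0"
proof -
  let ?S = "\<Sum>y\<in>N. cnj (c y) * (\<Sum>z\<in>N. of_real (stiffness z y) * c z)"
  have sym: "stiffness z y = stiffness y z" for z y
    by (simp add: stiffness_def inner_commute)
  have "cnj ?S = (\<Sum>y\<in>N. \<Sum>z\<in>N. of_real (stiffness z y) * (c y * cnj (c z)))"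
    by (simp add: sum_distrib_left mult_ac)
  also have "\<dots> = (\<Sum>z\<in>N. \<Sum>y\<in>N. of_real (stiffness z y) * (c y * cnj (c z)))"
    by (rule sum.swap)
  also have "\<dots> = ?S"
    by (simp add: sum_distrib_left sym mult_ac)
  finally have "?S \<in> \<real>" by (simp only: Reals_cnj_iff)
  then show ?thesis by (simp only: complex_is_Real_iff)
qed


text \<open>In coordinates: \<open>c\<close> holds the nodal values of the magnetic field (less its boundary value), \<open>U\<close> those
of the temperature and \<open>p\<close> those of its constrained part. The field is eliminated as a continuous
function of \<open>p\<close>, and \<open>p\<close> is a fixed point of the truncation of \<open>q + (b(q) - A q) / \<alpha>\<close>.\<close>

lemma discrete_solution_exists:
  fixes \<mu> :: "real \<Rightarrow> real" and \<omega> \<alpha> lo hi \<mu>_up :: real and h :: complex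
  assumes mu: "continuous_on UNIV \<mu>" "\<And>s. 0 < \<mu> s" "\<And>s. \<mu> s \<le> \<mu>_up"
    and "0 < \<omega>" "0 < \<alpha>" "lo < hi"
  shows "\<exists>p U c. (\<forall>z\<in>N. p z = max lo (min (U z) hi)) \<and>
    (\<forall>y\<in>N. (\<Sum>z\<in>N. (of_real (stiffness z y) + \<i> * of_real \<omega> * of_real (mass (\<lambda>x. \<mu> (comb p x)) z y)) * c z)
        = \<i> * of_real \<omega> * h * of_real (load (\<lambda>x. \<mu> (comb p x)) y)) \<and>
    (\<forall>y\<in>N. (\<Sum>z\<in>N. stiffness z y * p z) + \<alpha> * (U y - p y) = joule_load c y)"
proof -
  \<comment> \<open>Coefficient vectors become real sequences, as the fixed point lemma requires; \<open>e\<close> numbers the nodes.\<close>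
  obtain e :: "real ^ 2 \<Rightarrow> nat" and n where e: "bij_betw e N {..<n}"
    using ex_bij_betw_finite_nat[OF finite_nodes] by (auto simp: atLeast0LessThan)
  define w where "w = (\<lambda>(q :: nat \<Rightarrow> real) x. \<mu> (comb (\<lambda>z. q (e z)) x))"
  have w_cont: "continuous_on (closure \<Omega>) (w q)" for q
    unfolding w_def using continuous_on_compose2[OF mu(1) continuous_comb] by simp
  have "continuous_on UNIV (\<lambda>q :: nat \<Rightarrow> real. \<phi> z x *\<^sub>R q (e z))" for z x
    by (rule continuous_on_scaleR[OF continuous_on_const continuous_on_product_coordinates])
  then have "continuous_on UNIV (\<lambda>q :: nat \<Rightarrow> real. comb (\<lambda>z. q (e z)) x)" for x
    unfolding comb_def by (rule continuous_on_sum)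
  then have w_param: "continuous_on UNIV (\<lambda>q. w q x)" for x
    unfolding w_def by (rule continuous_on_compose2[OF mu(1)]) simp
  have w_bound: "\<bar>w q x\<bar> \<le> \<mu>_up" for q x
    using mu(2,3) by (simp add: w_def abs_of_pos)
  have par: "continuous_on UNIV (\<lambda>q. LINT x:\<Omega>|lebesgue. w q x * f x)"
    if f: "continuous_on (closure \<Omega>) f" for f
  proof (rule continuous_on_parametric_integral[OF open_dom bounded_dom, where w = "\<lambda>x. \<mu>_up * \<bar>f x\<bar>"])
    show "continuous_on (closure \<Omega>) (\<lambda>x. w q x * f x)" for q
      by (rule continuous_on_mult[OF w_cont f])
    show "continuous_on UNIV (\<lambda>q. w q x * f x)" for x
      by (rule continuous_on_mult_right[OF w_param])
    show "continuous_on (closure \<Omega>) (\<lambda>x. \<mu>_up * \<bar>f x\<bar>)"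
      by (rule continuous_on_mult_left[OF continuous_on_rabs[OF f]])
    show "\<bar>w q x * f x\<bar> \<le> \<mu>_up * \<bar>f x\<bar>" for q x
      unfolding abs_mult by (intro mult_right_mono w_bound) simp
  qed
  have mass_cont: "continuous_on UNIV (\<lambda>q. mass (w q) z y)" if "z \<in> N" "y \<in> N" for z y
    using par[OF continuous_on_mult[OF cont[OF that(1)] cont[OF that(2)]]] by (simp add: mass_def mult.assoc)
  have load_cont: "continuous_on UNIV (\<lambda>q. load (w q) y)" if "y \<in> N" for y
    using par[OF cont[OF that]] by (simp add: load_def)
  define M where "M = (\<lambda>y z q. of_real (stiffness z y) + \<i> * of_real \<omega> * of_real (mass (w q) z y))"
  have "\<exists>c :: real ^ 2 \<Rightarrow> (nat \<Rightarrow> real) \<Rightarrow> complex. (\<forall>z\<in>N. continuous_on UNIV (c z)) \<and>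
      (\<forall>q\<in>UNIV. \<forall>y\<in>N. (\<Sum>z\<in>N. M y z q * c z q) = \<i> * of_real \<omega> * h * of_real (load (w q) y))"
  proof (rule linear_system_continuous_solution[OF finite_nodes])
    show "continuous_on UNIV (M y z)" if "y \<in> N" "z \<in> N" for y z
      unfolding M_def by (intro continuous_intros mass_cont that)
    show "continuous_on UNIV (\<lambda>q. \<i> * of_real \<omega> * h * of_real (load (w q) y))" if "y \<in> N" for y
      by (intro continuous_intros load_cont that)
    fix q and c :: "real ^ 2 \<Rightarrow> complex" assume c: "\<exists>z\<in>N. c z \<noteq> 0"
    obtain s where s: "s > 0" "(\<Sum>y\<in>N. cnj (c y) * (\<Sum>z\<in>N. of_real (mass (w q) z y) * c z)) = of_real s"
      using mass_definite[OF w_cont[of q] _ c] mu(2) by (auto simp: w_def)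
    have "(\<Sum>y\<in>N. cnj (c y) * (\<Sum>z\<in>N. M y z q * c z))
        = (\<Sum>y\<in>N. cnj (c y) * (\<Sum>z\<in>N. of_real (stiffness z y) * c z))
          + \<i> * of_real \<omega> * (\<Sum>y\<in>N. cnj (c y) * (\<Sum>z\<in>N. of_real (mass (w q) z y) * c z))"
      by (simp add: M_def sum_distrib_left sum.distrib algebra_simps)
    also have "\<dots> = (\<Sum>y\<in>N. cnj (c y) * (\<Sum>z\<in>N. of_real (stiffness z y) * c z)) + \<i> * of_real (\<omega> * s)"
      by (simp add: s(2))
    finally have "Im (\<Sum>y\<in>N. cnj (c y) * (\<Sum>z\<in>N. M y z q * c z)) = \<omega> * s"
      using stiffness_form_real[of c] by simp
    moreover have "\<omega> * s \<noteq> Im 0" using s(1) assms(4) by simp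
    ultimately show "(\<Sum>y\<in>N. cnj (c y) * (\<Sum>z\<in>N. M y z q * c z)) \<noteq> 0" by metis
  qed
  then obtain c :: "real ^ 2 \<Rightarrow> (nat \<Rightarrow> real) \<Rightarrow> complex"
    where c: "(\<forall>z\<in>N. continuous_on UNIV (c z)) \<and> (\<forall>q\<in>UNIV. \<forall>y\<in>N.
      (\<Sum>z\<in>N. M y z q * c z q) = \<i> * of_real \<omega> * h * of_real (load (w q) y))"
    by (rule exE)
  have c_cont: "continuous_on UNIV (c z)" if "z \<in> N" for z
    using conjunct1[OF c] that by (rule bspec)
  have c_sol: "(\<Sum>z\<in>N. M y z q * c z q) = \<i> * of_real \<omega> * h * of_real (load (w q) y)" if "y \<in> N" for q y
    using bspec[OF conjunct2[OF c] UNIV_I[of q]] that by (rule bspec)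
  \<comment> \<open>The heat equation at node \<open>z\<close>, solved for the nodal value of the temperature when its constrained
    part is prescribed by \<open>q\<close>.\<close>
  define G where "G = (\<lambda>(q :: nat \<Rightarrow> real) z. q (e z) +
      (joule_load (\<lambda>z'. c z' q) z - (\<Sum>z'\<in>N. stiffness z' z * q (e z'))) / \<alpha>)"
  have "continuous_on UNIV (\<lambda>q. Re (c z q * cnj (c z' q)))" if "z \<in> N" "z' \<in> N" for z z'
    by (rule continuous_on_Re[OF continuous_on_mult[OF c_cont[OF that(1)] continuous_on_cnj[OF c_cont[OF that(2)]]]])
  then have joule_cont: "continuous_on UNIV (\<lambda>q. joule_load (\<lambda>z'. c z' q) z)" for z
    unfolding joule_load_def by (intro continuous_on_sum continuous_on_mult_left)
  have coord_cont: "continuous_on UNIV (\<lambda>q :: nat \<Rightarrow> real. q (e z))" for z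
    by (rule continuous_on_product_coordinates)
  have "continuous_on UNIV (\<lambda>q :: nat \<Rightarrow> real. \<Sum>z'\<in>N. stiffness z' z * q (e z'))" for z
    by (intro continuous_on_sum continuous_on_mult continuous_on_const coord_cont)
  then have G_cont: "continuous_on UNIV (\<lambda>q. G q z)" for z
    unfolding G_def divide_inverse
    by (intro continuous_on_add continuous_on_mult continuous_on_diff continuous_on_const coord_cont joule_cont)
  obtain q where q: "\<And>i. i < n \<Longrightarrow> max lo (min (G q (the_inv_into N e i)) hi) = q i"
    using clamped_map_fixed_point[OF assms(6), of n "\<lambda>q i. G q (the_inv_into N e i)"] G_cont by blast
  have e_inv: "e z < n" "the_inv_into N e (e z) = z" if "z \<in> N" for z
    using e that by (auto simp: bij_betw_def the_inv_into_f_f)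
  show ?thesis
  proof (rule exI[of _ "\<lambda>z. q (e z)"], rule exI[of _ "G q"], rule exI[of _ "\<lambda>z. c z q"],
      intro conjI ballI)
    show "q (e z) = max lo (min (G q z) hi)" if "z \<in> N" for z
      using q[OF e_inv(1)[OF that]] e_inv(2)[OF that] by simp
    show "(\<Sum>z\<in>N. (of_real (stiffness z y) + \<i> * of_real \<omega> * of_real (mass (\<lambda>x. \<mu> (comb (\<lambda>z. q (e z)) x)) z y)) * c z q)
        = \<i> * of_real \<omega> * h * of_real (load (\<lambda>x. \<mu> (comb (\<lambda>z. q (e z)) x)) y)" if "y \<in> N" for y
      using c_sol[OF that, of q] by (simp add: M_def w_def)
    show "(\<Sum>z\<in>N. stiffness z y * q (e z)) + \<alpha> * (G q y - q (e y)) = joule_load (\<lambda>z. c z q) y" for y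
      using assms(5) by (simp add: G_def)
  qed
qed

end

text \<open>The basis spans the real space; real and imaginary parts of a complex element belong to that.\<close>

lemma V_space_expansion_complex:
  fixes Q :: "real ^ 2 \<Rightarrow> complex"
  assumes "open \<Omega>" and basis: "lagrange_basis \<Omega> T \<phi>" and Q: "Q \<in> V_space \<Omega> T"
  shows "\<exists>d. \<forall>x\<in>closure \<Omega>. Q x = (\<Sum>z\<in>internal_nodes \<Omega> T. \<phi> z x *\<^sub>R d z)"
proof -
  have span: "\<exists>c. \<forall>x\<in>closure \<Omega>. v x = (\<Sum>z\<in>internal_nodes \<Omega> T. c z * \<phi> z x)" if "v \<in> V_space \<Omega> T" for v
    using basis that unfolding lagrange_basis_def by blast
  obtain a b where "\<forall>x\<in>closure \<Omega>. Re (Q x) = (\<Sum>z\<in>internal_nodes \<Omega> T. a z * \<phi> z x)"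
    "\<forall>x\<in>closure \<Omega>. Im (Q x) = (\<Sum>z\<in>internal_nodes \<Omega> T. b z * \<phi> z x)"
    using span[OF V_space_bounded_linear[OF assms(1) bounded_linear_Re Q]]
      span[OF V_space_bounded_linear[OF assms(1) bounded_linear_Im Q]] by blast
  then show ?thesis
    by (intro exI[of _ "\<lambda>z. Complex (a z) (b z)"]) (simp add: complex_eq_iff mult.commute)
qed

theorem theorem5p3:
  fixes \<Omega> :: "(real ^ 2) set"
    and I :: "real set"
    and T :: "real \<Rightarrow> (real ^ 2) set set"
    and \<phi> :: "real \<Rightarrow> real ^ 2 \<Rightarrow> real ^ 2 \<Rightarrow> real"
    and \<mu> :: "real \<Rightarrow> real"
    and \<omega> \<alpha> \<epsilon> k \<mu>_low \<mu>_up :: real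
    and H0 :: complex
  assumes domain: "lipschitz_polygonal_domain \<Omega>"
    and mesh: "shape_regular_family \<Omega> I T"
    and basis: "\<forall>h\<in>I. lagrange_basis \<Omega> (T h) (\<phi> h)"
    and omega: "0 < \<omega>"
    and mu_lipschitz: "\<exists>L. L-lipschitz_on UNIV \<mu>"
    and mu_bounds: "0 < \<mu>_low" "\<forall>s. \<mu>_low \<le> \<mu> s \<and> \<mu> s \<le> \<mu>_up"
    and alpha: "0 < \<alpha>"
    and eps_k: "0 < \<epsilon>" "\<epsilon> < k"
  shows "\<forall>h\<in>I. \<exists>u \<in> V_space \<Omega> (T h). \<exists>H \<in> W_space \<Omega> (T h).
    let N = internal_nodes \<Omega> (T h);
        u_plus = constrained_part N (\<phi> h) \<epsilon> k u;
        u_minus = complementary_part N (\<phi> h) \<epsilon> k u;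
        H_tilde = (\<lambda>x. H x - H0)
    in H_tilde \<in> V_space \<Omega> (T h) \<and>
       (\<forall>Q \<in> V_space \<Omega> (T h). \<forall>v \<in> V_space \<Omega> (T h).
          L2_complex_vec \<Omega> (grad \<Omega> H_tilde) (grad \<Omega> Q)
            + L2_complex \<Omega> (\<lambda>x. \<i> * of_real \<omega> * of_real (\<mu> (u_plus x)) * H_tilde x) Q
            = L2_complex \<Omega> (\<lambda>x. \<i> * of_real \<omega> * of_real (\<mu> (u_plus x)) * H0) Q \<and>
          L2_real_vec \<Omega> (grad \<Omega> u_plus) (grad \<Omega> v) + stab_form N \<alpha> u_minus v
            = L2_real \<Omega> (\<lambda>x. (norm (grad \<Omega> H x))\<^sup>2) v)"
proof
  fix h assume h: "h \<in> I"
  define N where "N = internal_nodes \<Omega> (T h)"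
  have dom: "open \<Omega>" "bounded \<Omega>" using domain by (auto simp: lipschitz_polygonal_domain_def)
  have sub: "\<Omega> \<subseteq> closure \<Omega>" by (rule closure_subset)
  have NO: "N \<subseteq> \<Omega>" by (auto simp: N_def internal_nodes_def)
  have N: "finite N"
    using mesh h finite_internal_nodes unfolding N_def shape_regular_family_def by blast
  have bas: "lagrange_basis \<Omega> (T h) (\<phi> h)" using basis h by blast
  have phi: "\<phi> h z \<in> V_space \<Omega> (T h)" "\<And>y. y \<in> N \<Longrightarrow> \<phi> h z y = (if y = z then 1 else 0)" if "z \<in> N" for z
    using bas that unfolding lagrange_basis_def N_def by blast+
  have "\<exists>g. has_weak_gradient \<Omega> (\<phi> h z) g \<and> square_integrable \<Omega> g" if "z \<in> N" for z
    using phi(1)[OF that] by (simp add: V_space_def H1_0_def H1_def)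
  then obtain g where g: "\<And>z. z \<in> N \<Longrightarrow> has_weak_gradient \<Omega> (\<phi> h z) (g z)"
    "\<And>z. z \<in> N \<Longrightarrow> square_integrable \<Omega> (g z)"
    by metis
  interpret nodal_basis \<Omega> N "\<phi> h" g
    by unfold_locales (use dom N NO phi g in \<open>auto simp: V_space_def W_space_def\<close>)
  have comb_V: "comb c \<in> V_space \<Omega> (T h)" for c :: "real ^ 2 \<Rightarrow> 'b::euclidean_space"
    unfolding comb_def by (intro V_space_sum dom N phi)
  obtain L where "L-lipschitz_on UNIV \<mu>" using mu_lipschitz by blast
  then have mu: "continuous_on UNIV \<mu>" by (rule lipschitz_on_continuous_on)
  have mu_pos: "0 < \<mu> s" and mu_le: "\<mu> s \<le> \<mu>_up" for s
    using mu_bounds(1) mu_bounds(2)[rule_format, of s] by auto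
  have box: "- \<epsilon> < k" using eps_k by linarith
  obtain p U c where p: "\<forall>z\<in>N. p z = max (- \<epsilon>) (min (U z) k)"
    and ceq: "\<forall>y\<in>N. (\<Sum>z\<in>N. (of_real (stiffness z y) + \<i> * of_real \<omega> * of_real (mass (\<lambda>x. \<mu> (comb p x)) z y)) * c z)
        = \<i> * of_real \<omega> * H0 * of_real (load (\<lambda>x. \<mu> (comb p x)) y)"
    and ueq: "\<forall>y\<in>N. (\<Sum>z\<in>N. stiffness z y * p z) + \<alpha> * (U y - p y) = joule_load c y"
    using discrete_solution_exists[OF mu mu_pos mu_le omega alpha box, of H0] by (elim exE conjE)
  define H where "H = (\<lambda>x. comb c x + H0)"
  have H: "H \<in> W_space \<Omega> (T h)"
    unfolding H_def using comb_V[of c] by (intro W_space_add W_space_const) (simp add: V_space_def)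
  have Ht: "H x - H0 = comb c x" for x by (simp add: H_def)
  have plus: "constrained_part N (\<phi> h) \<epsilon> k (comb U) = comb p"
    by (rule ext) (simp add: constrained_part_def comb_node p comb_def[of p] mult.commute)
  have minus: "complementary_part N (\<phi> h) \<epsilon> k (comb U) z = U z - p z" if "z \<in> N" for z
    using that by (simp add: complementary_part_def plus comb_node)
  have w: "continuous_on (closure \<Omega>) (\<lambda>x. \<mu> (comb p x))"
    using continuous_on_compose2[OF mu continuous_comb] by simp
  have magnetic: "L2_complex_vec \<Omega> (grad \<Omega> (comb c)) (grad \<Omega> Q)
        + L2_complex \<Omega> (\<lambda>x. \<i> * of_real \<omega> * of_real (\<mu> (comb p x)) * comb c x) Q
      = L2_complex \<Omega> (\<lambda>x. \<i> * of_real \<omega> * of_real (\<mu> (comb p x)) * H0) Q"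
    if Q: "Q \<in> V_space \<Omega> (T h)" for Q
  proof -
    obtain d where "\<forall>x\<in>closure \<Omega>. Q x = comb d x"
      using V_space_expansion_complex[OF dom(1) bas Q, folded N_def] unfolding comb_def by blast
    then have Qd: "\<And>x. x \<in> \<Omega> \<Longrightarrow> Q x = comb d x" using sub by blast
    have gQ: "grad \<Omega> Q = grad \<Omega> (comb d)" by (rule grad_cong) (rule Qd)
    have LQ: "L2_complex \<Omega> f Q = L2_complex \<Omega> f (comb d)" for f
      unfolding L2_complex_def set_lebesgue_integral_def
      by (intro Bochner_Integration.integral_cong refl) (auto simp: indicator_def Qd)
    have "(\<Sum>z\<in>N. \<Sum>y\<in>N. of_real (stiffness z y) * (c z * cnj (d y)))
        + (\<Sum>z\<in>N. \<Sum>y\<in>N. of_real (mass (\<lambda>x. \<mu> (comb p x)) z y) * (\<i> * of_real \<omega> * c z * cnj (d y)))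
      = (\<Sum>z\<in>N. \<Sum>y\<in>N. cnj (d y) * ((of_real (stiffness z y)
          + \<i> * of_real \<omega> * of_real (mass (\<lambda>x. \<mu> (comb p x)) z y)) * c z))"
      by (simp add: sum.distrib[symmetric] algebra_simps)
    also have "\<dots> = (\<Sum>y\<in>N. cnj (d y) * (\<Sum>z\<in>N. (of_real (stiffness z y)
          + \<i> * of_real \<omega> * of_real (mass (\<lambda>x. \<mu> (comb p x)) z y)) * c z))"
      by (subst sum.swap) (simp only: sum_distrib_left)
    also have "\<dots> = (\<Sum>y\<in>N. of_real (load (\<lambda>x. \<mu> (comb p x)) y) * (\<i> * of_real \<omega> * H0 * cnj (d y)))"
      by (rule sum.cong[OF refl]) (simp only: ceq[rule_format], simp add: mult_ac)
    finally show ?thesis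
      by (simp only: gQ LQ grad_form_complex[of c d] mass_form[OF w, of \<omega> c d] load_form[OF w, of \<omega> H0 d])
  qed
  have heat: "L2_real_vec \<Omega> (grad \<Omega> (comb p)) (grad \<Omega> v)
        + stab_form N \<alpha> (complementary_part N (\<phi> h) \<epsilon> k (comb U)) v
      = L2_real \<Omega> (\<lambda>x. (norm (grad \<Omega> H x))\<^sup>2) v"
    if v: "v \<in> V_space \<Omega> (T h)" for v
  proof -
    obtain q where "\<forall>x\<in>closure \<Omega>. v x = (\<Sum>z\<in>N. q z * \<phi> h z x)"
      using bas v unfolding lagrange_basis_def N_def by blast
    then have vq: "\<And>x. x \<in> \<Omega> \<Longrightarrow> v x = comb q x"
      using sub by (auto simp: comb_def mult.commute)
    have gv: "grad \<Omega> v = grad \<Omega> (comb q)" by (rule grad_cong) (rule vq)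
    have Lv: "L2_real \<Omega> f v = L2_real \<Omega> f (comb q)" for f
      unfolding L2_real_def set_lebesgue_integral_def
      by (intro Bochner_Integration.integral_cong refl) (auto simp: indicator_def vq)
    have st: "stab_form N \<alpha> (complementary_part N (\<phi> h) \<epsilon> k (comb U)) v = (\<Sum>y\<in>N. \<alpha> * (U y - p y) * q y)"
      unfolding stab_form_def sum_distrib_left
      using NO by (intro sum.cong refl) (auto simp: minus vq comb_node)
    have gH: "grad \<Omega> H = grad \<Omega> (comb c)" unfolding H_def by (rule grad_add_const)
    have "(\<Sum>z\<in>N. \<Sum>y\<in>N. stiffness z y * (p z * q y)) + (\<Sum>y\<in>N. \<alpha> * (U y - p y) * q y)
        = (\<Sum>y\<in>N. ((\<Sum>z\<in>N. stiffness z y * p z) + \<alpha> * (U y - p y)) * q y)"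
      by (subst sum.swap) (simp add: sum_distrib_right sum.distrib distrib_right mult.assoc)
    also have "\<dots> = (\<Sum>y\<in>N. joule_load c y * q y)"
      by (rule sum.cong[OF refl]) (simp only: ueq[rule_format])
    finally show ?thesis by (simp only: gv Lv st grad_form_real[of p q] joule_form[OF gH, of q])
  qed
  show "\<exists>u \<in> V_space \<Omega> (T h). \<exists>H \<in> W_space \<Omega> (T h).
    let N = internal_nodes \<Omega> (T h);
        u_plus = constrained_part N (\<phi> h) \<epsilon> k u;
        u_minus = complementary_part N (\<phi> h) \<epsilon> k u;
        H_tilde = (\<lambda>x. H x - H0)
    in H_tilde \<in> V_space \<Omega> (T h) \<and>
       (\<forall>Q \<in> V_space \<Omega> (T h). \<forall>v \<in> V_space \<Omega> (T h).
          L2_complex_vec \<Omega> (grad \<Omega> H_tilde) (grad \<Omega> Q)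
            + L2_complex \<Omega> (\<lambda>x. \<i> * of_real \<omega> * of_real (\<mu> (u_plus x)) * H_tilde x) Q
            = L2_complex \<Omega> (\<lambda>x. \<i> * of_real \<omega> * of_real (\<mu> (u_plus x)) * H0) Q \<and>
          L2_real_vec \<Omega> (grad \<Omega> u_plus) (grad \<Omega> v) + stab_form N \<alpha> u_minus v
            = L2_real \<Omega> (\<lambda>x. (norm (grad \<Omega> H x))\<^sup>2) v)"
    unfolding Let_def N_def[symmetric]
  proof (rule bexI[OF _ comb_V[of U]], rule bexI[OF _ H], unfold plus Ht, rule conjI[OF comb_V], intro ballI)
    fix Q :: "real ^ 2 \<Rightarrow> complex" and v :: "real ^ 2 \<Rightarrow> real"
    assume "Q \<in> V_space \<Omega> (T h)" "v \<in> V_space \<Omega> (T h)"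
    from magnetic[OF this(1)] heat[OF this(2)]
    show "L2_complex_vec \<Omega> (grad \<Omega> (comb c)) (grad \<Omega> Q)
          + L2_complex \<Omega> (\<lambda>x. \<i> * of_real \<omega> * of_real (\<mu> (comb p x)) * comb c x) Q
        = L2_complex \<Omega> (\<lambda>x. \<i> * of_real \<omega> * of_real (\<mu> (comb p x)) * H0) Q \<and>
      L2_real_vec \<Omega> (grad \<Omega> (comb p)) (grad \<Omega> v)
          + stab_form N \<alpha> (complementary_part N (\<phi> h) \<epsilon> k (comb U)) v
        = L2_real \<Omega> (\<lambda>x. (norm (grad \<Omega> H x))\<^sup>2) v"
      by (rule conjI)
  qed
qed

end
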